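(* Let $\lambda,\lambda'\in(S^1)^n$ and let $$\omega=s_{[a_k,b_k]}s_{[a_{k-1},b_{k-1}]}\cdots s_{[a_1,b_1]},\qquad \omega'=s_{[a'_{k'},b'_{k'}]}s_{[a'_{k'-1},b'_{k'-1}]}\cdots s_{[a'_1,b'_1]}$$ be two reduced words in $\mathfrak S_{n+1}$, where $1\le k,k'\le n$, $1\le b_k<\cdots<b_1\le n$, $1\le a_i\le b_i$ for $1\le i\le k$, and $1\le b'_{k'}<\cdots<b'_1\le n$, $1\le a'_i\le b'_i$ for $1\le i\le k'$. If $(\lambda,\omega)\ne(\lambda',\omega')$, then the representations $\psi_{\lambda,\omega}$ and $\psi_{\lambda',\omega'}$ of $C(SU_0(n+1))$ are (unitarily) inequivalent.
   Context: Fix an integer $n\ge 2$. $C(SU_0(n+1))$ denotes the universal unital $C^*$-algebra generated by elements $z_{i,j}$, $1\le i,j\le n+1$, subject to the following relations (empty products are $1$): (1) $z_{i,j}z_{i,l}=0$ if $j<l$; (2) $z_{i,j}z_{k,j}=0$ if $i<k$; (3) $z_{i,l}z_{k,j}=z_{k,j}z_{i,l}$ if $i<k$ and $j<l$; (4) $z_{i,l}z_{k,j}=0$ if $i<k$, $j<l$ and $\max\{i,j\}\ge\min\{k,l\}$; (5) $z_{i,j}z_{k,l}-z_{k,l}z_{i,j}=z_{i,l}z_{k,j}$ if $i<k$, $j<l$ and $\max\{i,j\}+1=\min\{k,l\}$; (6) $z_{i,j}z_{k,l}=z_{k,l}z_{i,j}$ if $i<k$, $j<l$ and $\max\{i,j\}+1<\min\{k,l\}$;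 (7) $z_{1,1}z_{2,2}\cdots z_{n+1,n+1}=1$; (8) $z_{i,j}z_{r,s}^*=z_{r,s}^*z_{i,j}$ if $i\ne r$ and $j\neq s$; (9) $z_{r,s}^*=(z_{1,1}\cdots z_{s-1,s-1})(z_{s,s+1}z_{s+1,s+2}\cdots z_{r-1,r})(z_{r+1,r+1}\cdots z_{n+1,n+1})$ if $r>s$; $z_{r,s}^*=(z_{1,1}\cdots z_{r-1,r-1})(z_{r+1,r}z_{r+2,r+1}\cdots z_{s,s-1})(z_{s+1,s+1}\cdots z_{n+1,n+1})$ if $r<s$; $z_{r,r}^*=(z_{1,1}\cdots z_{r-1,r-1})(z_{r+1,r+1}\cdots z_{n+1,n+1})$. Words: $s_i=(i,i+1)$, $1\le i\le n$, are the transpositions generating the symmetric group $\mathfrak S_{n+1}$, and for $a\le b$, $s_{[a,b]}:=s_bs_{b-1}\cdots s_a$. The representations $\psi_{\lambda,\omega}$: $\mathbb N=\{0,1,2,\dots\}$; on $\ell^2(\mathbb N)$, $S$ is the left shift ($Se_m=e_{m-1}$ for $m\ge1$, $Se_0=0$) and $Ne_m=me_m$. For $0<q<1$ and $1\le r\le n$ let $\psi^{(q)}_{s_r}(u_{i,j})$ be the operator on $\ell^2(\mathbb N)$ equal to $S\sqrt{I-q^{2N}}$ if $i=j=r$; $\sqrt{I-q^{2N}}S^*$ if $i=j=r+1$; $-q^{N+1}$ if $(i,j)=(r,r+1)$; $q^N$ if $(i,j)=(r+1,r)$; $\delta_{i,j}I$ otherwise. For $\lambda\in(S^1)^n$ put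 $\lambda_0=\lambda_{n+1}=1$. For a reduced word $\omega=s_{i_1}s_{i_2}\cdots s_{i_m}$ put $$\psi^{(q)}_{\lambda,\omega}(u_{i,j})=\overline{\lambda}_{i-1}\lambda_i\sum_{k_1,\dots,k_{m-1}=1}^{n+1}\psi^{(q)}_{s_{i_1}}(u_{i,k_1})\otimes\psi^{(q)}_{s_{i_2}}(u_{k_1,k_2})\otimes\cdots\otimes\psi^{(q)}_{s_{i_m}}(u_{k_{m-1},j})$$ on $\ell^2(\mathbb N)^{\otimes m}$. Then $\psi_{\lambda,\omega}$ is the representation of $C(SU_0(n+1))$ on $\ell^2(\mathbb N)^{\otimes m}$ determined by $$\psi_{\lambda,\omega}(z_{i,j})=\lim_{q\to0+}(-q)^{\min\{i-j,0\}}\psi^{(q)}_{\lambda,\omega}(u_{i,j}),$$ where the limits exist in operator norm and satisfy relations (1)–(9). *)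

theory Defs
  imports "HOL-Analysis.Analysis" "HOL-Algebra.Ring" "HOL-Combinatorics.Transposition"
begin

section \<open>Unital C*-algebras, with explicit carriers\<close>

record 'a cstar = "'a ring" +
  scale :: "complex \<Rightarrow> 'a \<Rightarrow> 'a"
  adj :: "'a \<Rightarrow> 'a"
  cnorm :: "'a \<Rightarrow> real"

locale unital_cstar_algebra = ring A for A :: "('a, 'm) cstar_scheme" (structure) +
  assumes scale_closed: "x \<in> carrier A \<Longrightarrow> scale A c x \<in> carrier A"
    and scale_add_right: "\<lbrakk>x \<in> carrier A; y \<in> carrier A\<rbrakk> \<Longrightarrow>
           scale A c (x \<oplus> y) = scale A c x \<oplus> scale A c y"
    and scale_add_left: "x \<in> carrier A \<Longrightarrow> scale A (c + d) x = scale A c x \<oplus> scale A d x"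
    and scale_scale: "x \<in> carrier A \<Longrightarrow> scale A c (scale A d x) = scale A (c * d) x"
    and scale_one: "x \<in> carrier A \<Longrightarrow> scale A 1 x = x"
    and scale_mult_left: "\<lbrakk>x \<in> carrier A; y \<in> carrier A\<rbrakk> \<Longrightarrow>
           scale A c (x \<otimes> y) = scale A c x \<otimes> y"
    and scale_mult_right: "\<lbrakk>x \<in> carrier A; y \<in> carrier A\<rbrakk> \<Longrightarrow>
           scale A c (x \<otimes> y) = x \<otimes> scale A c y"
    and adj_closed: "x \<in> carrier A \<Longrightarrow> adj A x \<in> carrier A"
    and adj_adj: "x \<in> carrier A \<Longrightarrow> adj A (adj A x) = x"
    and adj_add: "\<lbrakk>x \<in> carrier A; y \<in> carrier A\<rbrakk> \<Longrightarrow> adj A (x \<oplus> y) = adj A x \<oplus> adj A y"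
    and adj_scale: "x \<in> carrier A \<Longrightarrow> adj A (scale A c x) = scale A (cnj c) (adj A x)"
    and adj_mult: "\<lbrakk>x \<in> carrier A; y \<in> carrier A\<rbrakk> \<Longrightarrow> adj A (x \<otimes> y) = adj A y \<otimes> adj A x"
    and cnorm_eq_0: "x \<in> carrier A \<Longrightarrow> cnorm A x = 0 \<longleftrightarrow> x = \<zero>"
    and cnorm_triangle: "\<lbrakk>x \<in> carrier A; y \<in> carrier A\<rbrakk> \<Longrightarrow>
           cnorm A (x \<oplus> y) \<le> cnorm A x + cnorm A y"
    and cnorm_scale: "x \<in> carrier A \<Longrightarrow> cnorm A (scale A c x) = cmod c * cnorm A x"
    and cnorm_mult: "\<lbrakk>x \<in> carrier A; y \<in> carrier A\<rbrakk> \<Longrightarrow>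
           cnorm A (x \<otimes> y) \<le> cnorm A x * cnorm A y"
    and cstar_identity: "x \<in> carrier A \<Longrightarrow> cnorm A (adj A x \<otimes> x) = (cnorm A x)\<^sup>2"
    and complete: "\<lbrakk>\<And>k::nat. X k \<in> carrier A;
           \<And>e. e > 0 \<Longrightarrow> \<exists>K. \<forall>k\<ge>K. \<forall>l\<ge>K. cnorm A (X k \<ominus> X l) < e\<rbrakk> \<Longrightarrow>
           \<exists>x\<in>carrier A. (\<lambda>k. cnorm A (X k \<ominus> x)) \<longlonglongrightarrow> 0"

definition cstar_tendsto ::
    "('a, 'm) cstar_scheme \<Rightarrow> ('c \<Rightarrow> 'a) \<Rightarrow> 'a \<Rightarrow> 'c filter \<Rightarrow> bool" where
  "cstar_tendsto A X x F \<longleftrightarrow> x \<in> carrier A \<and> (\<forall>\<^sub>F t in F. X t \<in> carrier A) \<and>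
     ((\<lambda>t. cnorm A (X t \<ominus>\<^bsub>A\<^esub> x)) \<longlongrightarrow> 0) F"

definition cstar_subalgebra :: "('a, 'm) cstar_scheme \<Rightarrow> 'a set \<Rightarrow> bool" where
  "cstar_subalgebra A B \<longleftrightarrow> B \<subseteq> carrier A \<and> \<one>\<^bsub>A\<^esub> \<in> B \<and>
     (\<forall>x\<in>B. \<forall>y\<in>B. x \<oplus>\<^bsub>A\<^esub> y \<in> B \<and> x \<otimes>\<^bsub>A\<^esub> y \<in> B) \<and>
     (\<forall>c. \<forall>x\<in>B. scale A c x \<in> B) \<and> (\<forall>x\<in>B. adj A x \<in> B) \<and>
     (\<forall>X x. (\<forall>k::nat. X k \<in> B) \<longrightarrow> cstar_tendsto A X x sequentially \<longrightarrow> x \<in> B)"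

definition cstar_generated :: "('a, 'm) cstar_scheme \<Rightarrow> 'a set \<Rightarrow> bool" where
  "cstar_generated A G \<longleftrightarrow> G \<subseteq> carrier A \<and>
     (\<forall>B. cstar_subalgebra A B \<longrightarrow> G \<subseteq> B \<longrightarrow> B = carrier A)"

definition unital_star_hom ::
    "('a, 'm) cstar_scheme \<Rightarrow> ('b, 'k) cstar_scheme \<Rightarrow> ('a \<Rightarrow> 'b) \<Rightarrow> bool" where
  "unital_star_hom A B \<phi> \<longleftrightarrow> \<phi> \<in> ring_hom A B \<and>
     (\<forall>c. \<forall>x\<in>carrier A. \<phi> (scale A c x) = scale B c (\<phi> x)) \<and>
     (\<forall>x\<in>carrier A. \<phi> (adj A x) = adj B (\<phi> x))"


section \<open>Bounded operators on the Hilbert spaces of square-summable families\<close>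

definition l2 :: "'i set \<Rightarrow> ('i \<Rightarrow> complex) set" where
  "l2 I = {f. (\<forall>x. x \<notin> I \<longrightarrow> f x = 0) \<and> (\<lambda>x. (cmod (f x))\<^sup>2) summable_on I}"

definition l2_inner :: "('i \<Rightarrow> complex) \<Rightarrow> ('i \<Rightarrow> complex) \<Rightarrow> complex" where
  "l2_inner f g = (\<Sum>\<^sub>\<infinity>x. f x * cnj (g x))"

definition l2_norm :: "('i \<Rightarrow> complex) \<Rightarrow> real" where
  "l2_norm f = sqrt (\<Sum>\<^sub>\<infinity>x. (cmod (f x))\<^sup>2)"

definition linear_on_l2 ::
    "'i set \<Rightarrow> (('i \<Rightarrow> complex) \<Rightarrow> ('j \<Rightarrow> complex)) \<Rightarrow> bool" where
  "linear_on_l2 I T \<longleftrightarrow>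
     (\<forall>f\<in>l2 I. \<forall>g\<in>l2 I. T (\<lambda>x. f x + g x) = (\<lambda>x. T f x + T g x)) \<and>
     (\<forall>c. \<forall>f\<in>l2 I. T (\<lambda>x. c * f x) = (\<lambda>x. c * T f x))"

definition bounded_ops :: "'i set \<Rightarrow> (('i \<Rightarrow> complex) \<Rightarrow> ('i \<Rightarrow> complex)) set" where
  "bounded_ops I = {T \<in> l2 I \<rightarrow>\<^sub>E l2 I. linear_on_l2 I T \<and>
     (\<exists>C. \<forall>f\<in>l2 I. l2_norm (T f) \<le> C * l2_norm f)}"

text \<open>The C*-algebra of bounded operators on \<open>l2 I\<close>.  Operators are extensional functions, so that
  equality of operators is equality in HOL.\<close>

definition l2_ops :: "'i set \<Rightarrow> (('i \<Rightarrow> complex) \<Rightarrow> ('i \<Rightarrow> complex)) cstar" where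
  "l2_ops I = \<lparr>
     carrier = bounded_ops I,
     mult = (\<lambda>T R. compose (l2 I) T R),
     one = (\<lambda>f\<in>l2 I. f),
     zero = (\<lambda>f\<in>l2 I. (\<lambda>x. 0)),
     add = (\<lambda>T R. \<lambda>f\<in>l2 I. (\<lambda>x. T f x + R f x)),
     scale = (\<lambda>c T. \<lambda>f\<in>l2 I. (\<lambda>x. c * T f x)),
     adj = (\<lambda>T. THE R. R \<in> bounded_ops I \<and>
              (\<forall>f\<in>l2 I. \<forall>g\<in>l2 I. l2_inner (R f) g = l2_inner f (T g))),
     cnorm = (\<lambda>T. SUP f \<in> {f \<in> l2 I. l2_norm f \<le> 1}. l2_norm (T f))\<rparr>"

abbreviation representation ::
    "('a, 'm) cstar_scheme \<Rightarrow> 'i set \<Rightarrow> ('a \<Rightarrow> ('i \<Rightarrow> complex) \<Rightarrow> ('i \<Rightarrow> complex)) \<Rightarrow> bool" where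
  "representation A I \<pi> \<equiv> unital_star_hom A (l2_ops I) \<pi>"

definition l2_unitary ::
    "'i set \<Rightarrow> 'j set \<Rightarrow> (('i \<Rightarrow> complex) \<Rightarrow> ('j \<Rightarrow> complex)) \<Rightarrow> bool" where
  "l2_unitary I J U \<longleftrightarrow> linear_on_l2 I U \<and> bij_betw U (l2 I) (l2 J) \<and>
     (\<forall>f\<in>l2 I. \<forall>g\<in>l2 I. l2_inner (U f) (U g) = l2_inner f g)"

definition unitarily_equivalent ::
    "('a, 'm) cstar_scheme \<Rightarrow> 'i set \<Rightarrow> ('a \<Rightarrow> ('i \<Rightarrow> complex) \<Rightarrow> ('i \<Rightarrow> complex)) \<Rightarrow>
     'j set \<Rightarrow> ('a \<Rightarrow> ('j \<Rightarrow> complex) \<Rightarrow> ('j \<Rightarrow> complex)) \<Rightarrow> bool" where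
  "unitarily_equivalent A I \<pi> J \<rho> \<longleftrightarrow>
     (\<exists>U. l2_unitary I J U \<and> (\<forall>x\<in>carrier A. \<forall>f\<in>l2 I. U (\<pi> x f) = \<rho> x (U f)))"


section \<open>The C*-algebra \<open>C(SU\<^sub>0(n+1))\<close>\<close>

definition list_prod :: "('a, 'm) monoid_scheme \<Rightarrow> 'a list \<Rightarrow> 'a" where
  "list_prod A xs = foldr (mult A) xs \<one>\<^bsub>A\<^esub>"

text \<open>The right-hand side of the relation expressing \<open>z r s\<close>* through the generators.\<close>

definition SU0_cofactor ::
    "nat \<Rightarrow> ('a, 'm) cstar_scheme \<Rightarrow> (nat \<Rightarrow> nat \<Rightarrow> 'a) \<Rightarrow> nat \<Rightarrow> nat \<Rightarrow> 'a" where
  "SU0_cofactor n A z r s =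
     (if s < r then
        list_prod A (map (\<lambda>t. z t t) [1..<s]) \<otimes>\<^bsub>A\<^esub>
        list_prod A (map (\<lambda>t. z t (t + 1)) [s..<r]) \<otimes>\<^bsub>A\<^esub>
        list_prod A (map (\<lambda>t. z t t) [r + 1..<n + 2])
      else if r < s then
        list_prod A (map (\<lambda>t. z t t) [1..<r]) \<otimes>\<^bsub>A\<^esub>
        list_prod A (map (\<lambda>t. z (t + 1) t) [r..<s]) \<otimes>\<^bsub>A\<^esub>
        list_prod A (map (\<lambda>t. z t t) [s + 1..<n + 2])
      else
        list_prod A (map (\<lambda>t. z t t) [1..<r]) \<otimes>\<^bsub>A\<^esub>
        list_prod A (map (\<lambda>t. z t t) [r + 1..<n + 2]))"

definition SU0_relations ::
    "nat \<Rightarrow> ('a, 'm) cstar_scheme \<Rightarrow> (nat \<Rightarrow> nat \<Rightarrow> 'a) \<Rightarrow> bool" where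
  "SU0_relations n A z \<longleftrightarrow>
     (\<forall>i\<in>{1..n+1}. \<forall>j\<in>{1..n+1}. z i j \<in> carrier A) \<and>
     (\<forall>i\<in>{1..n+1}. \<forall>j\<in>{1..n+1}. \<forall>l\<in>{1..n+1}.
        j < l \<longrightarrow> z i j \<otimes>\<^bsub>A\<^esub> z i l = \<zero>\<^bsub>A\<^esub>) \<and>
     (\<forall>i\<in>{1..n+1}. \<forall>j\<in>{1..n+1}. \<forall>k\<in>{1..n+1}.
        i < k \<longrightarrow> z i j \<otimes>\<^bsub>A\<^esub> z k j = \<zero>\<^bsub>A\<^esub>) \<and>
     (\<forall>i\<in>{1..n+1}. \<forall>j\<in>{1..n+1}. \<forall>k\<in>{1..n+1}. \<forall>l\<in>{1..n+1}. i < k \<longrightarrow> j < l \<longrightarrow>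
        z i l \<otimes>\<^bsub>A\<^esub> z k j = z k j \<otimes>\<^bsub>A\<^esub> z i l \<and>
        (max i j \<ge> min k l \<longrightarrow> z i l \<otimes>\<^bsub>A\<^esub> z k j = \<zero>\<^bsub>A\<^esub>) \<and>
        (max i j + 1 = min k l \<longrightarrow>
           z i j \<otimes>\<^bsub>A\<^esub> z k l \<ominus>\<^bsub>A\<^esub> z k l \<otimes>\<^bsub>A\<^esub> z i j = z i l \<otimes>\<^bsub>A\<^esub> z k j) \<and>
        (max i j + 1 < min k l \<longrightarrow> z i j \<otimes>\<^bsub>A\<^esub> z k l = z k l \<otimes>\<^bsub>A\<^esub> z i j)) \<and>
     list_prod A (map (\<lambda>t. z t t) [1..<n + 2]) = \<one>\<^bsub>A\<^esub> \<and>
     (\<forall>i\<in>{1..n+1}. \<forall>j\<in>{1..n+1}. \<forall>r\<in>{1..n+1}. \<forall>s\<in>{1..n+1}. i \<noteq> r \<longrightarrow> j \<noteq> s \<longrightarrow>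
        z i j \<otimes>\<^bsub>A\<^esub> adj A (z r s) = adj A (z r s) \<otimes>\<^bsub>A\<^esub> z i j) \<and>
     (\<forall>r\<in>{1..n+1}. \<forall>s\<in>{1..n+1}. adj A (z r s) = SU0_cofactor n A z r s)"

text \<open>\<open>A\<close> with generators \<open>z\<close> is the universal unital C*-algebra for these relations.  The test
  algebras \<open>B\<close> have their elements in a fixed type.  Nothing is lost: only the C*-subalgebra of \<open>B\<close>
  generated by the images of the generators matters, it is separable and hence of cardinality at
  most the continuum, so it has an isomorphic copy in this type; and the algebras
  \<open>l2_ops {ks. length ks = m}\<close> used below are literally of this type.  Uniqueness of \<open>\<phi>\<close> on
  \<open>carrier A\<close> is a consequence of generation.\<close>

definition is_C_SU0 :: "nat \<Rightarrow> ('a, 'm) cstar_scheme \<Rightarrow> (nat \<Rightarrow> nat \<Rightarrow> 'a) \<Rightarrow> bool" where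
  "is_C_SU0 n A z \<longleftrightarrow> unital_cstar_algebra A \<and> SU0_relations n A z \<and>
     cstar_generated A {z i j | i j. i \<in> {1..n+1} \<and> j \<in> {1..n+1}} \<and>
     (\<forall>(B :: ((nat list \<Rightarrow> complex) \<Rightarrow> (nat list \<Rightarrow> complex)) cstar) w.
        unital_cstar_algebra B \<longrightarrow> SU0_relations n B w \<longrightarrow>
        (\<exists>\<phi>. unital_star_hom A B \<phi> \<and>
             (\<forall>i\<in>{1..n+1}. \<forall>j\<in>{1..n+1}. \<phi> (z i j) = w i j)))"


section \<open>Words in the transpositions \<open>s\<^sub>i = (i, i+1)\<close>\<close>

text \<open>A word is the list of the indices of its letters.\<close>

definition word_perm :: "nat list \<Rightarrow> nat \<Rightarrow> nat" where
  "word_perm w = foldr (\<lambda>i p. Transposition.transpose i (i + 1) \<circ> p) w id"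

definition reduced_word :: "nat \<Rightarrow> nat list \<Rightarrow> bool" where
  "reduced_word n w \<longleftrightarrow> set w \<subseteq> {1..n} \<and>
     (\<forall>v. set v \<subseteq> {1..n} \<longrightarrow> word_perm v = word_perm w \<longrightarrow> length w \<le> length v)"

definition s_interval :: "nat \<Rightarrow> nat \<Rightarrow> nat list" where
  "s_interval a b = rev [a..<b + 1]"

definition interval_word :: "nat \<Rightarrow> (nat \<Rightarrow> nat) \<Rightarrow> (nat \<Rightarrow> nat) \<Rightarrow> nat list" where
  "interval_word k a b = concat (map (\<lambda>i. s_interval (a i) (b i)) (rev [1..<k + 1]))"


section \<open>The representations \<open>\<psi>\<close>\<close>

definition left_shift :: "(nat \<Rightarrow> complex) \<Rightarrow> nat \<Rightarrow> complex" where
  "left_shift f = (\<lambda>m. f (m + 1))"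

definition right_shift :: "(nat \<Rightarrow> complex) \<Rightarrow> nat \<Rightarrow> complex" where
  "right_shift f = (\<lambda>m. if m = 0 then 0 else f (m - 1))"

lemma right_shift_adjoint: "l2_inner (right_shift f) g = l2_inner f (left_shift g)"
proof -
  have "l2_inner (right_shift f) g = (\<Sum>\<^sub>\<infinity>m\<in>range Suc. right_shift f m * cnj (g m))"
    unfolding l2_inner_def
    by (rule infsum_cong_neutral) (auto simp: right_shift_def image_iff gr0_conv_Suc)
  also have "\<dots> = (\<Sum>\<^sub>\<infinity>m. right_shift f (Suc m) * cnj (g (Suc m)))"
    by (subst infsum_reindex) (auto simp: o_def)
  finally show ?thesis
    by (simp add: l2_inner_def left_shift_def right_shift_def)
qed

definition diag_op :: "(nat \<Rightarrow> real) \<Rightarrow> (nat \<Rightarrow> complex) \<Rightarrow> nat \<Rightarrow> complex" where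
  "diag_op d f = (\<lambda>m. of_real (d m) * f m)"

definition psi_letter ::
    "real \<Rightarrow> nat \<Rightarrow> nat \<Rightarrow> nat \<Rightarrow> (nat \<Rightarrow> complex) \<Rightarrow> nat \<Rightarrow> complex" where
  "psi_letter q r i j =
     (if i = r \<and> j = r then left_shift \<circ> diag_op (\<lambda>m. sqrt (1 - q ^ (2 * m)))
      else if i = r + 1 \<and> j = r + 1 then diag_op (\<lambda>m. sqrt (1 - q ^ (2 * m))) \<circ> right_shift
      else if i = r \<and> j = r + 1 then diag_op (\<lambda>m. - (q ^ (m + 1)))
      else if i = r + 1 \<and> j = r then diag_op (\<lambda>m. q ^ m)
      else if i = j then id
      else (\<lambda>f m. 0))"

text \<open>The \<open>m\<close>-fold Hilbert space tensor power of \<open>l2 UNIV\<close> (over \<open>nat\<close>) is realised as square-summable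
  functions on the lists of length \<open>m\<close>, the basis vector \<open>e k\<^sub>1 \<otimes> \<dots> \<otimes> e k\<^sub>m\<close> being the indicator
  function of \<open>[k\<^sub>1, \<dots>, k\<^sub>m]\<close>.\<close>

abbreviation tensor_index :: "nat \<Rightarrow> nat list set" where
  "tensor_index m \<equiv> {ks. length ks = m}"

text \<open>\<open>T\<^sub>1 \<otimes> (T\<^sub>2 \<otimes> \<dots> \<otimes> T\<^sub>m)\<close> applies \<open>T\<^sub>2 \<otimes> \<dots> \<otimes> T\<^sub>m\<close> to the slices with the first coordinate fixed and then
  \<open>T\<^sub>1\<close> in the first coordinate; the lemma below gives its action on elementary tensors.\<close>

fun tensor_op ::
    "((nat \<Rightarrow> complex) \<Rightarrow> nat \<Rightarrow> complex) list \<Rightarrow> (nat list \<Rightarrow> complex) \<Rightarrow> nat list \<Rightarrow> complex" where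
  "tensor_op [] f ks = f ks"
| "tensor_op (T # Ts) f [] = 0"
| "tensor_op (T # Ts) f (k # ks) = T (\<lambda>l. tensor_op Ts (\<lambda>ls. f (l # ls)) ks) k"

fun tensor_vec :: "(nat \<Rightarrow> complex) list \<Rightarrow> nat list \<Rightarrow> complex" where
  "tensor_vec [] [] = 1"
| "tensor_vec (v # vs) (k # ks) = v k * tensor_vec vs ks"
| "tensor_vec _ _ = 0"

lemma tensor_op_scale:
  assumes "\<forall>T\<in>set Ts. \<forall>c v k. T (\<lambda>m. c * v m) k = c * T v k"
  shows "tensor_op Ts (\<lambda>ls. c * f ls) ks = c * tensor_op Ts f ks"
  using assms by (induction Ts f ks rule: tensor_op.induct) simp_all

lemma tensor_op_tensor_vec:
  assumes "length Ts = length vs"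
    and "\<forall>T\<in>set Ts. \<forall>c v k. T (\<lambda>m. c * v m) k = c * T v k"
  shows "tensor_op Ts (tensor_vec vs) = tensor_vec (map2 (\<lambda>T v. T v) Ts vs)"
  using assms
proof (induction Ts vs rule: list_induct2)
  case Nil
  show ?case by (auto simp: fun_eq_iff)
next
  case (Cons T Ts v vs)
  show ?case
  proof
    fix ks
    show "tensor_op (T # Ts) (tensor_vec (v # vs)) ks =
        tensor_vec (map2 (\<lambda>T v. T v) (T # Ts) (v # vs)) ks"
    proof (cases ks)
      case (Cons k ks')
      have IH: "tensor_op Ts (tensor_vec vs) ks' = tensor_vec (map2 (\<lambda>T v. T v) Ts vs) ks'"
        using Cons.IH Cons.prems by simp
      have *: "tensor_op Ts (\<lambda>ls. v l * tensor_vec vs ls) ks' =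
          tensor_vec (map2 (\<lambda>T v. T v) Ts vs) ks' * v l" for l
        using Cons.prems IH by (subst tensor_op_scale) (auto simp: mult.commute)
      have "T (\<lambda>l. tensor_vec (map2 (\<lambda>T v. T v) Ts vs) ks' * v l) k =
          tensor_vec (map2 (\<lambda>T v. T v) Ts vs) ks' * T v k"
        using Cons.prems by simp
      then show ?thesis
        using \<open>ks = k # ks'\<close> by (simp add: * mult.commute)
    qed simp
  qed
qed

text \<open>The convention \<open>\<lambda>\<^sub>0 = \<lambda>\<^sub>n\<^sub>+\<^sub>1 = 1\<close>.\<close>

definition ext_lam :: "nat \<Rightarrow> (nat \<Rightarrow> complex) \<Rightarrow> nat \<Rightarrow> complex" where
  "ext_lam n lam i = (if i \<in> {1..n} then lam i else 1)"

text \<open>The sum over \<open>k\<^sub>1, \<dots>, k\<^bsub>m-1\<^esub>\<close> is taken over the lists \<open>p = [i, k\<^sub>1, \<dots>, k\<^bsub>m-1\<^esub>, j]\<close>.\<close>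

definition psi_q ::
    "nat \<Rightarrow> real \<Rightarrow> (nat \<Rightarrow> complex) \<Rightarrow> nat list \<Rightarrow> nat \<Rightarrow> nat \<Rightarrow>
     (nat list \<Rightarrow> complex) \<Rightarrow> nat list \<Rightarrow> complex" where
  "psi_q n q lam w i j = (\<lambda>f\<in>l2 (tensor_index (length w)). \<lambda>ks.
     cnj (ext_lam n lam (i - 1)) * ext_lam n lam i *
     (\<Sum>p | length p = length w + 1 \<and> set p \<subseteq> {1..n+1} \<and> p ! 0 = i \<and> p ! length w = j.
        tensor_op (map (\<lambda>t. psi_letter q (w ! t) (p ! t) (p ! (t + 1))) [0..<length w]) f ks))"

definition is_psi ::
    "nat \<Rightarrow> ('a, 'm) cstar_scheme \<Rightarrow> (nat \<Rightarrow> nat \<Rightarrow> 'a) \<Rightarrow> (nat \<Rightarrow> complex) \<Rightarrow> nat list \<Rightarrow>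
     ('a \<Rightarrow> (nat list \<Rightarrow> complex) \<Rightarrow> (nat list \<Rightarrow> complex)) \<Rightarrow> bool" where
  "is_psi n A z lam w \<psi> \<longleftrightarrow> representation A (tensor_index (length w)) \<psi> \<and>
     (\<forall>i\<in>{1..n+1}. \<forall>j\<in>{1..n+1}.
        cstar_tendsto (l2_ops (tensor_index (length w)))
          (\<lambda>q. scale (l2_ops (tensor_index (length w)))
                 (of_real ((- q) powi min (int i - int j) 0)) (psi_q n q lam w i j))
          (\<psi> (z i j)) (at_right 0))"

end

theory Submission
  imports Defs
begin

text \<open>
  On and below the diagonal, i.e. for \<open>j \<le> i\<close>, the power of \<open>-q\<close> in the definition of \<open>\<psi> (z i j)\<close>
  has exponent \<open>0\<close> and the limit \<open>q \<rightarrow> 0\<close> is obtained by putting \<open>q = 0\<close>.  There every letter of the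
  word acts deterministically: a particle sits in row \<open>i\<close>, runs through the sites of the tensor
  product from left to right, and at a site with letter \<open>s r\<close> its row and the occupation number \<open>k\<close>
  found there determine the next row and the new occupation number.  So for every basis index \<open>ks\<close>
  exactly one path contributes, and \<open>\<psi> (z i j) f\<close> has the value \<open>c i * f ks'\<close> or \<open>0\<close> at \<open>ks\<close>, according to
  whether the particle leaves in row \<open>j\<close>, where \<open>c i\<close> is the scalar made of \<open>lam (i - 1)\<close> and \<open>lam i\<close>, and
  \<open>ks'\<close> is the list of the new occupation numbers (\<open>path_sum_at_0\<close>, \<open>representation_generator\<close>).

  Up to empty blocks, a word of the given form is a product of blocks \<open>s_interval (\<alpha> r) r\<close> for
  \<open>r = 1, \<dots>, n\<close> with \<open>1 \<le> \<alpha> r \<le> r + 1\<close>.  A particle that starts in row \<open>n + 1\<close> meets only the last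
  block, and it leaves in row \<open>\<alpha> n\<close>, the lowest row possible, exactly when this block is in its vacuum
  state.  Hence \<open>\<psi> (z (n + 1) j) = 0\<close> for \<open>j < \<alpha> n\<close>, while \<open>\<psi> (z (n + 1) (\<alpha> n))\<close> is \<open>c (n + 1)\<close> times the
  projection onto the vacuum of the last block (\<open>top_row_op\<close>).  The vanishing pattern of row \<open>n + 1\<close>
  therefore gives \<open>\<alpha> n\<close>, and idempotency of the projection gives \<open>c (n + 1)\<close>.

  Between two copies of this projection, products of the generators restore the generators for the
  word without its last block (\<open>row_op_compress\<close>): for \<open>j < \<alpha> n\<close> it is \<open>z i j\<close> itself, and for
  \<open>j \<ge> \<alpha> n\<close> it is \<open>z i (\<alpha> n)\<close> after \<open>z (n + 1) (j + 1)\<close>; the second factor accepts exactly the single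
  excitation that the first one leaves at the site of the letter \<open>j\<close>.  A unitary that intertwines
  two representations thus also intertwines the compressed operators, and induction on the number of
  blocks recovers all \<open>\<alpha> r\<close> and all \<open>c i\<close>, hence the word and the \<open>lam i\<close>
  (\<open>intertwined_rows_determine_word\<close>, \<open>ext_lam_determined\<close>).
\<close>

section \<open>Representations of the generators at \<open>q = 0\<close>\<close>

text \<open>At \<open>q = 0\<close> the entries of the matrix of a letter \<open>r\<close> are the left shift at \<open>(r, r)\<close>, the right shift
  at \<open>(r + 1, r + 1)\<close>, the projection onto the basis vector \<open>e 0\<close> at \<open>(r + 1, r)\<close> and the identity at the
  other diagonal positions; the entry at \<open>(r, r + 1)\<close> vanishes.  The occupation numbers
  describe the action on functions by substitution, so the left shift raises them.\<close>

definition next_row :: "nat \<Rightarrow> nat \<Rightarrow> nat \<Rightarrow> nat" where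
  "next_row r i k = (if i = r + 1 \<and> k = 0 then r else i)"

definition next_occ :: "nat \<Rightarrow> nat \<Rightarrow> nat \<Rightarrow> nat" where
  "next_occ r i k = (if i = r then k + 1 else if i = r + 1 then k - 1 else k)"

fun exit_row :: "nat list \<Rightarrow> nat \<Rightarrow> nat list \<Rightarrow> nat" where
  "exit_row [] i ks = i"
| "exit_row (r # w) i ks = exit_row w (next_row r i (hd ks)) (tl ks)"

fun occ_after :: "nat list \<Rightarrow> nat \<Rightarrow> nat list \<Rightarrow> nat list" where
  "occ_after [] i ks = ks"
| "occ_after (r # w) i ks = next_occ r i (hd ks) # occ_after w (next_row r i (hd ks)) (tl ks)"

lemma exit_row_le: "exit_row w i ks \<le> i"
proof (induction w arbitrary: i ks)
  case (Cons r w)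
  have "exit_row w (next_row r i (hd ks)) (tl ks) \<le> next_row r i (hd ks)"
    by (rule Cons.IH)
  also have "\<dots> \<le> i" by (simp add: next_row_def)
  finally show ?case by simp
qed simp

lemma length_occ_after: "length w \<le> length ks \<Longrightarrow> length (occ_after w i ks) = length ks"
  by (induction w arbitrary: i ks) (auto simp: Suc_le_eq)

lemma exit_row_append:
  "length ks = length w \<Longrightarrow>
     exit_row (w @ v) i (ks @ ls) = exit_row v (exit_row w i ks) ls"
  by (induction w arbitrary: i ks) (auto simp: length_Suc_conv)

lemma occ_after_append:
  "length ks = length w \<Longrightarrow>
     occ_after (w @ v) i (ks @ ls) = occ_after w i ks @ occ_after v (exit_row w i ks) ls"
  by (induction w arbitrary: i ks) (auto simp: length_Suc_conv)

lemma exit_row_above: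
  "\<forall>r\<in>set w. r + 1 < i \<Longrightarrow> exit_row w i ks = i"
  by (induction w arbitrary: ks) (auto simp: next_row_def)

lemma occ_after_above:
  "\<forall>r\<in>set w. r + 1 < i \<Longrightarrow> length w \<le> length ks \<Longrightarrow> occ_after w i ks = ks"
proof (induction w arbitrary: ks)
  case (Cons r w)
  then show ?case by (cases ks) (auto simp: next_row_def next_occ_def)
qed simp

text \<open>The two entries of row \<open>r + 1\<close> are the right shift, whose values live on \<open>k > 0\<close>, and the projection
  onto \<open>e 0\<close>, whose values live on \<open>k = 0\<close>.  This disjointness makes the next row a function of \<open>k\<close>.\<close>

lemma psi_letter_0:
  "psi_letter 0 r i x F k = (if x = next_row r i k then F (next_occ r i k) else 0)"
  by (cases k) (auto simp: psi_letter_def next_row_def next_occ_def left_shift_def right_shift_def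
      diag_op_def)

definition paths :: "nat \<Rightarrow> nat \<Rightarrow> nat \<Rightarrow> nat \<Rightarrow> nat list set" where
  "paths n m i j = {p. length p = m + 1 \<and> set p \<subseteq> {1..n+1} \<and> p ! 0 = i \<and> p ! m = j}"

lemma finite_paths: "finite (paths n m i j)"
  by (rule finite_subset[OF _ finite_lists_length_eq[of "{1..n+1}" "m+1"]])
    (auto simp: paths_def)

text \<open>By \<open>psi_letter_0\<close> a path contributes only if each of its steps is the one that the occupation number
  at this site prescribes, which leaves a single path.\<close>

lemma path_sum_at_0:
  assumes "set w \<subseteq> {1..n}" "i \<in> {1..n+1}" "length ks = length w"
  shows "(\<Sum>p\<in>paths n (length w) i j.
      tensor_op (map (\<lambda>t. psi_letter 0 (w ! t) (p ! t) (p ! (t + 1))) [0..<length w]) f ks) =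
    (if exit_row w i ks = j then f (occ_after w i ks) else 0)"
  using assms
proof (induction w arbitrary: i ks f)
  case Nil
  have "paths n 0 i j = (if i = j then {[i]} else {})"
    using Nil.prems by (auto simp: paths_def length_Suc_conv)
  then show ?case using Nil.prems by (simp del: One_nat_def)
next
  case (Cons r w)
  obtain k ks' where ks: "ks = k # ks'" "length ks' = length w"
    using Cons.prems by (auto simp: length_Suc_conv)
  let ?x = "next_row r i k"
  let ?g = "\<lambda>ls. f (next_occ r i k # ls)"
  let ?T = "\<lambda>w p. map (\<lambda>t. psi_letter 0 (w ! t) (p ! t) (p ! (t + 1))) [0..<length w]"
  have x: "?x \<in> {1..n+1}"
    using Cons.prems by (auto simp: next_row_def)
  have T: "?T (r # w) (i # p) = psi_letter 0 r i (p ! 0) # ?T w p" for p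
    by (simp add: upt_conv_Cons map_Suc_upt[symmetric] del: upt_Suc)
  have sub: "(\<lambda>p. i # p) ` paths n (length w) ?x j \<subseteq> paths n (length (r # w)) i j"
    using Cons.prems by (auto simp: paths_def)
  have "(\<Sum>p\<in>paths n (length (r # w)) i j. tensor_op (?T (r # w) p) f ks) =
      (\<Sum>p\<in>(\<lambda>p. i # p) ` paths n (length w) ?x j. tensor_op (?T (r # w) p) f ks)"
  proof (rule sum.mono_neutral_right[OF finite_paths sub], intro ballI)
    fix p assume "p \<in> paths n (length (r # w)) i j - (\<lambda>p. i # p) ` paths n (length w) ?x j"
    then obtain p' where p: "p = i # p'" "p' ! 0 \<noteq> ?x"
      by (fastforce simp: paths_def length_Suc_conv)
    show "tensor_op (?T (r # w) p) f ks = 0"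
      unfolding p(1) T ks(1) using p(2) by (simp add: psi_letter_0)
  qed
  also have "\<dots> = (\<Sum>p\<in>paths n (length w) ?x j. tensor_op (?T (r # w) (i # p)) f ks)"
    by (subst sum.reindex) (auto simp: inj_on_def)
  also have "\<dots> = (\<Sum>p\<in>paths n (length w) ?x j. tensor_op (?T w p) ?g ks')"
    unfolding T ks(1) by (rule sum.cong) (auto simp: psi_letter_0 paths_def)
  also have "\<dots> = (if exit_row w ?x ks' = j then ?g (occ_after w ?x ks') else 0)"
    using Cons.IH[of ?x ks' ?g] Cons.prems x ks by simp
  finally show ?case using ks by simp
qed

lemma psi_letter_apply:
  "psi_letter q r i x F k =
     (if i = r \<and> x = r then of_real (sqrt (1 - q ^ (2 * (k + 1)))) * F (k + 1)
      else if i = r + 1 \<and> x = r + 1 then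
        of_real (sqrt (1 - q ^ (2 * k))) * (if k = 0 then 0 else F (k - 1))
      else if i = r \<and> x = r + 1 then of_real (- (q ^ (k + 1))) * F k
      else if i = r + 1 \<and> x = r then of_real (q ^ k) * F k
      else if i = x then F k else 0)"
  by (simp add: psi_letter_def left_shift_def right_shift_def diag_op_def)

text \<open>The argument \<open>g\<close> may depend on \<open>q\<close> too, since in a tensor product it contains the action of the
  letters further to the right.\<close>

lemma psi_letter_tendsto_0:
  assumes g: "\<And>l. ((\<lambda>q. g q l) \<longlongrightarrow> g 0 l) (at_right 0)"
  shows "((\<lambda>q. psi_letter q r i x (g q) k) \<longlongrightarrow> psi_letter 0 r i x (g 0) k) (at_right 0)"
proof -
  have q: "((\<lambda>q::real. q) \<longlongrightarrow> 0) (at_right 0)"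
    by (rule tendsto_ident_at)
  have S: "((\<lambda>q. of_real (sqrt (1 - q ^ m)) * h q) \<longlongrightarrow> of_real (sqrt (1 - 0 ^ m)) * h 0) (at_right 0)"
    if "(h \<longlongrightarrow> h 0) (at_right 0)" for m and h :: "real \<Rightarrow> complex"
    by (intro tendsto_mult tendsto_of_real tendsto_real_sqrt tendsto_diff tendsto_power tendsto_const
        q that)
  have P: "((\<lambda>q. of_real (q ^ m) * h q) \<longlongrightarrow> of_real (0 ^ m) * h 0) (at_right 0)"
    "((\<lambda>q. of_real (- (q ^ m)) * h q) \<longlongrightarrow> of_real (- (0 ^ m)) * h 0) (at_right 0)"
    if "(h \<longlongrightarrow> h 0) (at_right 0)" for m and h :: "real \<Rightarrow> complex"
    by (intro tendsto_mult tendsto_of_real tendsto_minus tendsto_power q that)+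
  have pred: "((\<lambda>q. if k = 0 then 0 else g q (k - 1)) \<longlongrightarrow> (if k = 0 then 0 else g 0 (k - 1)))
      (at_right 0)"
    using g by (cases "k = 0") simp_all
  have If: "((\<lambda>q. if c then f q else h q) \<longlongrightarrow> (if c then f 0 else h 0)) (at_right 0)"
    if "(f \<longlongrightarrow> f 0) (at_right 0)" "(h \<longlongrightarrow> h 0) (at_right 0)"
    for c and f h :: "real \<Rightarrow> complex"
    using that by (cases c) simp_all
  show ?thesis
    unfolding psi_letter_apply
    by (rule If[OF S[OF g] If[OF S[OF pred] If[OF P(2)[OF g] If[OF P(1)[OF g]
        If[OF g tendsto_const]]]]])
qed

lemma tensor_op_tendsto_0:
  assumes "\<And>ls. ((\<lambda>q. g q ls) \<longlongrightarrow> g 0 ls) (at_right 0)"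
  shows "((\<lambda>q. tensor_op (map (\<lambda>t. psi_letter q (R t) (I t) (J t)) ts) (g q) ks) \<longlongrightarrow>
     tensor_op (map (\<lambda>t. psi_letter 0 (R t) (I t) (J t)) ts) (g 0) ks) (at_right 0)"
  using assms
proof (induction ts arbitrary: g ks)
  case (Cons t ts)
  show ?case
  proof (cases ks)
    case ks: (Cons k ks')
    have IH: "((\<lambda>q. tensor_op (map (\<lambda>t. psi_letter q (R t) (I t) (J t)) ts) (\<lambda>ls. g q (l # ls)) ks') \<longlongrightarrow>
        tensor_op (map (\<lambda>t. psi_letter 0 (R t) (I t) (J t)) ts) (\<lambda>ls. g 0 (l # ls)) ks') (at_right 0)" for l
      by (rule Cons.IH[where g = "\<lambda>q ls. g q (l # ls)"], rule Cons.prems)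
    show ?thesis unfolding ks list.map tensor_op.simps
      by (rule psi_letter_tendsto_0[where g = "\<lambda>q l. tensor_op
        (map (\<lambda>t. psi_letter q (R t) (I t) (J t)) ts) (\<lambda>ls. g q (l # ls)) ks'"], rule IH)
  qed simp
qed simp


section \<open>Pointwise limits of norm convergent families of operators\<close>

lemma l2_summable:
  assumes "f \<in> l2 I"
  shows "(\<lambda>x. (cmod (f x))\<^sup>2) summable_on UNIV"
proof -
  have "(\<lambda>x. (cmod (f x))\<^sup>2) summable_on I"
    using assms by (simp add: l2_def)
  also have "?this \<longleftrightarrow> ?thesis"
    by (rule summable_on_cong_neutral) (use assms in \<open>auto simp: l2_def\<close>)
  finally show ?thesis .
qed

lemma l2_iff: "f \<in> l2 I \<longleftrightarrow> (\<forall>x. x \<notin> I \<longrightarrow> f x = 0) \<and> (\<lambda>x. (cmod (f x))\<^sup>2) summable_on UNIV"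
  by (auto simp: l2_summable) (auto simp: l2_def intro: summable_on_subset_banach)

lemma l2_norm_power2: "(l2_norm f)\<^sup>2 = (\<Sum>\<^sub>\<infinity>x. (cmod (f x))\<^sup>2)"
  unfolding l2_norm_def by (rule real_sqrt_pow2) (simp add: infsum_nonneg)

lemma l2_norm_nonneg: "0 \<le> l2_norm f"
  unfolding l2_norm_def by (simp add: infsum_nonneg)

lemma cmod_le_l2_norm:
  assumes "f \<in> l2 I"
  shows "cmod (f x) \<le> l2_norm f"
proof (rule power2_le_imp_le[OF _ l2_norm_nonneg])
  have "(cmod (f x))\<^sup>2 = (\<Sum>\<^sub>\<infinity>y\<in>{x}. (cmod (f y))\<^sup>2)" by simp
  also have "\<dots> \<le> (\<Sum>\<^sub>\<infinity>y. (cmod (f y))\<^sup>2)"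
    by (rule infsum_mono_neutral) (auto intro: l2_summable[OF assms])
  finally show "(cmod (f x))\<^sup>2 \<le> (l2_norm f)\<^sup>2" by (simp add: l2_norm_power2)
qed

lemma l2_scale: "f \<in> l2 I \<Longrightarrow> (\<lambda>x. c * f x) \<in> l2 I"
  by (auto simp: l2_iff norm_mult power_mult_distrib intro: summable_on_cmult_right)

lemma l2_norm_scale: "l2_norm (\<lambda>x. c * f x) = cmod c * l2_norm f"
  unfolding l2_norm_def
  by (simp add: norm_mult power_mult_distrib infsum_cmult_right' real_sqrt_mult)

lemma cmod_add_power2_le: "(cmod (u + v))\<^sup>2 \<le> 2 * (cmod u)\<^sup>2 + 2 * (cmod v)\<^sup>2"
proof -
  have "(cmod (u + v))\<^sup>2 \<le> (cmod u + cmod v)\<^sup>2"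
    by (simp add: norm_triangle_ineq power_mono)
  also have "\<dots> \<le> 2 * (cmod u)\<^sup>2 + 2 * (cmod v)\<^sup>2"
    using sum_squares_bound[of "cmod u" "cmod v"] by (simp add: power2_sum)
  finally show ?thesis .
qed

lemma
  assumes "f \<in> l2 I" "g \<in> l2 I"
  shows l2_add: "(\<lambda>x. f x + g x) \<in> l2 I"
    and l2_norm_add_power2_le:
      "(l2_norm (\<lambda>x. f x + g x))\<^sup>2 \<le> 2 * (l2_norm f)\<^sup>2 + 2 * (l2_norm g)\<^sup>2"
proof -
  have s: "(\<lambda>x. 2 * (cmod (f x))\<^sup>2 + 2 * (cmod (g x))\<^sup>2) summable_on UNIV"
    using assms by (intro summable_on_add summable_on_cmult_right l2_summable)
  have s': "(\<lambda>x. (cmod (f x + g x))\<^sup>2) summable_on UNIV"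
    by (rule summable_on_comparison_test[OF s]) (auto simp: cmod_add_power2_le)
  then show "(\<lambda>x. f x + g x) \<in> l2 I"
    using assms by (auto simp: l2_iff)
  have "(l2_norm (\<lambda>x. f x + g x))\<^sup>2 \<le> (\<Sum>\<^sub>\<infinity>x. 2 * (cmod (f x))\<^sup>2 + 2 * (cmod (g x))\<^sup>2)"
    unfolding l2_norm_power2 by (rule infsum_mono[OF s' s]) (rule cmod_add_power2_le)
  also have "\<dots> = 2 * (l2_norm f)\<^sup>2 + 2 * (l2_norm g)\<^sup>2"
    unfolding l2_norm_power2 using assms
    by (subst infsum_add) (auto simp: infsum_cmult_right' intro!: summable_on_cmult_right l2_summable)
  finally show "(l2_norm (\<lambda>x. f x + g x))\<^sup>2 \<le> 2 * (l2_norm f)\<^sup>2 + 2 * (l2_norm g)\<^sup>2" .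
qed

lemma l2_delta:
  assumes "x \<in> I"
  shows "(\<lambda>y. if y = x then 1 else 0) \<in> l2 I"
proof -
  have "(\<lambda>y. (cmod (if y = x then 1 else 0))\<^sup>2) summable_on UNIV"
    by (rule finite_nonzero_values_imp_summable_on) auto
  then show ?thesis using assms by (auto simp: l2_iff)
qed

text \<open>Subtraction in \<open>l2_ops\<close> is defined through the inverse in the additive monoid, so negatives have to
  be exhibited before differences can be evaluated.\<close>

lemma bounded_ops_uminus:
  assumes "T \<in> bounded_ops I"
  shows "(\<lambda>f\<in>l2 I. \<lambda>x. - T f x) \<in> bounded_ops I"
proof -
  obtain C where C: "\<forall>f\<in>l2 I. l2_norm (T f) \<le> C * l2_norm f"
    using assms by (auto simp: bounded_ops_def)
  have lin: "linear_on_l2 I T" and mem: "\<And>f. f \<in> l2 I \<Longrightarrow> T f \<in> l2 I"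
    using assms by (auto simp: bounded_ops_def)
  have "linear_on_l2 I (\<lambda>f\<in>l2 I. \<lambda>x. - T f x)"
    using lin by (auto simp: linear_on_l2_def l2_add l2_scale)
  moreover have "\<forall>f\<in>l2 I. l2_norm ((\<lambda>f\<in>l2 I. \<lambda>x. - T f x) f) \<le> C * l2_norm f"
    using C l2_norm_scale[of "-1" "T f" for f] by simp
  moreover have "(\<lambda>f\<in>l2 I. \<lambda>x. - T f x) \<in> l2 I \<rightarrow>\<^sub>E l2 I"
    using mem l2_scale[of _ I "-1"] by auto
  ultimately show ?thesis by (auto simp: bounded_ops_def)
qed

lemma l2_ops_minus:
  assumes T: "T \<in> bounded_ops I" and f: "f \<in> l2 I"
  shows "(X \<ominus>\<^bsub>l2_ops I\<^esub> T) f = (\<lambda>x. X f x - T f x)"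
proof -
  let ?M = "\<lambda>f\<in>l2 I. \<lambda>x. - T f x"
  have "\<ominus>\<^bsub>l2_ops I\<^esub> T = ?M"
    unfolding a_inv_def m_inv_def
  proof (rule the_equality)
    show "?M \<in> carrier (add_monoid (l2_ops I)) \<and>
        T \<otimes>\<^bsub>add_monoid (l2_ops I)\<^esub> ?M = \<one>\<^bsub>add_monoid (l2_ops I)\<^esub> \<and>
        ?M \<otimes>\<^bsub>add_monoid (l2_ops I)\<^esub> T = \<one>\<^bsub>add_monoid (l2_ops I)\<^esub>"
      using bounded_ops_uminus[OF T] by (auto simp: l2_ops_def fun_eq_iff restrict_def)
  next
    fix R
    assume R: "R \<in> carrier (add_monoid (l2_ops I)) \<and>
        T \<otimes>\<^bsub>add_monoid (l2_ops I)\<^esub> R = \<one>\<^bsub>add_monoid (l2_ops I)\<^esub> \<and>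
        R \<otimes>\<^bsub>add_monoid (l2_ops I)\<^esub> T = \<one>\<^bsub>add_monoid (l2_ops I)\<^esub>"
    then have ext: "R \<in> extensional (l2 I)"
      and sum: "(\<lambda>f\<in>l2 I. (\<lambda>x. T f x + R f x)) = (\<lambda>f\<in>l2 I. (\<lambda>x. 0))"
      by (auto simp: l2_ops_def bounded_ops_def PiE_def)
    show "R = ?M"
    proof (rule extensionalityI[OF ext restrict_extensional])
      fix g assume g: "g \<in> l2 I"
      have "(\<lambda>x. T g x + R g x) = (\<lambda>x. 0)"
        using fun_cong[OF sum, of g] g by simp
      then show "R g = ?M g"
        using g by (auto simp: fun_eq_iff add_eq_0_iff2 dest!: fun_cong)
    qed
  qed
  then show ?thesis
    using f by (simp add: a_minus_def l2_ops_def)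
qed

text \<open>The norm of an operator is a supremum over the unit ball, which is informative only because the
  difference is bounded there.  Adding \<open>1\<close> to the norm of \<open>f\<close> allows rescaling \<open>f\<close> into the unit ball
  also if \<open>f\<close> is zero.\<close>

lemma cmod_diff_le_cnorm:
  assumes X: "X \<in> bounded_ops I" and T: "T \<in> bounded_ops I" and f: "f \<in> l2 I"
  shows "cmod (X f x - T f x) \<le> (l2_norm f + 1) * cnorm (l2_ops I) (X \<ominus>\<^bsub>l2_ops I\<^esub> T)"
proof -
  let ?D = "X \<ominus>\<^bsub>l2_ops I\<^esub> T"
  let ?B = "{f \<in> l2 I. l2_norm f \<le> 1}"
  let ?s = "l2_norm f + 1"
  have s: "?s > 0" using l2_norm_nonneg[of f] by linarith
  have D: "?D g = (\<lambda>x. X g x + (-1) * T g x)" if "g \<in> l2 I" for g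
    unfolding l2_ops_minus[OF T that] by simp
  have mem: "X g \<in> l2 I" "T g \<in> l2 I" if "g \<in> l2 I" for g
    using X T that by (auto simp: bounded_ops_def)
  have Dmem: "?D g \<in> l2 I" if "g \<in> l2 I" for g
    unfolding D[OF that] by (intro l2_add l2_scale mem that)
  obtain C where C: "\<And>g. g \<in> l2 I \<Longrightarrow> l2_norm (X g) \<le> C * l2_norm g"
    using X by (auto simp: bounded_ops_def)
  obtain E where E: "\<And>g. g \<in> l2 I \<Longrightarrow> l2_norm (T g) \<le> E * l2_norm g"
    using T by (auto simp: bounded_ops_def)
  have bound: "l2_norm (?D g) \<le> sqrt (2 * C\<^sup>2 + 2 * E\<^sup>2)" if "g \<in> ?B" for g
  proof (rule real_le_rsqrt)
    have "g \<in> l2 I" using that by simp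
    have *: "(l2_norm h)\<^sup>2 \<le> K\<^sup>2" if "l2_norm h \<le> K * l2_norm g" for h K
    proof -
      have "(l2_norm h)\<^sup>2 \<le> (K * l2_norm g)\<^sup>2"
        using that l2_norm_nonneg[of h] by (rule power_mono)
      also have "\<dots> \<le> K\<^sup>2 * 1"
        unfolding power_mult_distrib using \<open>g \<in> ?B\<close> l2_norm_nonneg[of g]
        by (intro mult_left_mono) (auto simp: power_le_one)
      finally show ?thesis by simp
    qed
    have "(l2_norm (?D g))\<^sup>2 \<le> 2 * (l2_norm (X g))\<^sup>2 + 2 * (l2_norm (\<lambda>x. (-1) * T g x))\<^sup>2"
      unfolding D[OF \<open>g \<in> l2 I\<close>]
      by (intro l2_norm_add_power2_le[where I = I] mem l2_scale) fact+
    also have "\<dots> \<le> 2 * C\<^sup>2 + 2 * E\<^sup>2"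
      unfolding l2_norm_scale using *[OF C[OF \<open>g \<in> l2 I\<close>]] *[OF E[OF \<open>g \<in> l2 I\<close>]] by simp
    finally show "(l2_norm (?D g))\<^sup>2 \<le> 2 * C\<^sup>2 + 2 * E\<^sup>2" .
  qed
  let ?g = "\<lambda>x. of_real (1 / ?s) * f x"
  have g: "?g \<in> ?B"
  proof -
    have "l2_norm ?g = l2_norm f / ?s"
      using s unfolding l2_norm_scale norm_of_real by simp
    then show ?thesis
      using l2_scale[OF f, of "of_real (1 / ?s)"] s by (simp only: mem_Collect_eq) simp
  qed
  have hom: "Y ?g x = of_real (1 / ?s) * Y f x" if "Y \<in> bounded_ops I" for Y
  proof -
    have "\<forall>c. \<forall>f\<in>l2 I. Y (\<lambda>x. c * f x) = (\<lambda>x. c * Y f x)"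
      using that by (simp add: bounded_ops_def linear_on_l2_def)
    from this[rule_format, OF f, of "of_real (1 / ?s)"] show ?thesis by simp
  qed
  have "?g \<in> l2 I" using g by simp
  then have "?D ?g x = of_real (1 / ?s) * (X f x - T f x)"
    unfolding l2_ops_minus[OF T \<open>?g \<in> l2 I\<close>] hom[OF X] hom[OF T] by (simp only: right_diff_distrib)
  then have "cmod (X f x - T f x) = ?s * cmod (?D ?g x)"
    using s by (simp only: norm_mult norm_of_real) simp
  also have "\<dots> \<le> ?s * l2_norm (?D ?g)"
    using s g by (intro mult_left_mono cmod_le_l2_norm[OF Dmem]) auto
  also have "\<dots> \<le> ?s * (SUP g \<in> ?B. l2_norm (?D g))"
    using s g bound by (intro mult_left_mono cSUP_upper) (auto intro!: bdd_aboveI)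
  finally show ?thesis by (simp add: l2_ops_def)
qed

lemma cstar_tendsto_pointwise:
  assumes "cstar_tendsto (l2_ops I) X T F" "f \<in> l2 I"
  shows "((\<lambda>t. X t f x) \<longlongrightarrow> T f x) F"
proof -
  have T: "T \<in> bounded_ops I" and X: "\<forall>\<^sub>F t in F. X t \<in> bounded_ops I"
    and lim: "((\<lambda>t. cnorm (l2_ops I) (X t \<ominus>\<^bsub>l2_ops I\<^esub> T)) \<longlongrightarrow> 0) F"
    using assms(1) by (auto simp: cstar_tendsto_def l2_ops_def)
  have "((\<lambda>t. (l2_norm f + 1) * cnorm (l2_ops I) (X t \<ominus>\<^bsub>l2_ops I\<^esub> T)) \<longlongrightarrow> 0) F"
    using tendsto_mult_right_zero[OF lim] by simp
  then have "((\<lambda>t. X t f x - T f x) \<longlongrightarrow> 0) F"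
    by (rule Lim_null_comparison[rotated])
      (use X in \<open>auto elim!: eventually_mono intro: cmod_diff_le_cnorm[OF _ T assms(2)]\<close>)
  then show ?thesis by (simp add: LIM_zero_iff)
qed


section \<open>Blocks of decreasing letters\<close>

text \<open>The projection onto the functions that live on the vacuum of all sites from position \<open>l\<close> on.\<close>

definition vac_proj :: "nat \<Rightarrow> nat \<Rightarrow> (nat list \<Rightarrow> complex) \<Rightarrow> nat list \<Rightarrow> complex" where
  "vac_proj m l f = (\<lambda>ks. if length ks = m \<and> set (drop l ks) \<subseteq> {0} then f ks else 0)"

text \<open>The generators, without their scalars, of the representation for the word \<open>w\<close>, tensored with the
  vacuum projection on the remaining sites.  In this way the operators for all prefixes of a word
  act on the same space, and one intertwining map serves them all.\<close>

definition row_op ::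
    "nat \<Rightarrow> nat list \<Rightarrow> nat \<Rightarrow> nat \<Rightarrow> (nat list \<Rightarrow> complex) \<Rightarrow> nat list \<Rightarrow> complex" where
  "row_op m w i j f = (\<lambda>ks.
     if length ks = m \<and> set (drop (length w) ks) \<subseteq> {0} \<and> exit_row w i ks = j
     then f (occ_after w i ks) else 0)"

lemma s_interval_Suc: "a \<le> Suc N \<Longrightarrow> s_interval a (Suc N) = Suc N # s_interval a N"
  by (simp add: s_interval_def)

lemma s_interval_empty: "N < a \<Longrightarrow> s_interval a N = []"
  by (simp add: s_interval_def)

lemma length_s_interval: "length (s_interval a N) = N + 1 - a"
  by (cases "a \<le> N") (auto simp: s_interval_def Suc_diff_le)

lemma set_s_interval: "set (s_interval a N) = {a..N}"
  by (auto simp: s_interval_def)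

text \<open>The particle starts one row above the largest letter.  It moves down one row at each empty site; at
  the first occupied site it stays, and from then on no letter touches its row.\<close>

lemma block_top_row:
  assumes "1 \<le> a" "a \<le> N + 1" "N + 1 - a \<le> length ks"
  shows "a \<le> exit_row (s_interval a N) (N + 1) ks"
    and "exit_row (s_interval a N) (N + 1) ks = a \<longleftrightarrow> set (take (N + 1 - a) ks) \<subseteq> {0}"
    and "exit_row (s_interval a N) (N + 1) ks = a \<Longrightarrow> occ_after (s_interval a N) (N + 1) ks = ks"
proof -
  have "a \<le> exit_row (s_interval a N) (N + 1) ks \<and>
     (exit_row (s_interval a N) (N + 1) ks = a \<longleftrightarrow> set (take (N + 1 - a) ks) \<subseteq> {0}) \<and>
     (exit_row (s_interval a N) (N + 1) ks = a \<longrightarrow> occ_after (s_interval a N) (N + 1) ks = ks)"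
    using assms
  proof (induction N arbitrary: ks)
    case 0
    then show ?case by (simp add: s_interval_empty)
  next
    case (Suc N)
    show ?case
    proof (cases "a = Suc N + 1")
      case True
      then show ?thesis by (simp add: s_interval_empty)
    next
      case False
      with Suc.prems have a: "a \<le> Suc N" by simp
      with Suc.prems obtain k ks' where ks: "ks = k # ks'" by (cases ks) auto
      have up: "exit_row (s_interval a N) (Suc (Suc N)) ks' = Suc (Suc N)"
        by (rule exit_row_above) (auto simp: set_s_interval)
      show ?thesis
        using Suc.IH[of ks'] a Suc.prems up
        by (auto simp: ks s_interval_Suc next_row_def next_occ_def Suc_diff_le)
    qed
  qed
  then show "a \<le> exit_row (s_interval a N) (N + 1) ks"
    "exit_row (s_interval a N) (N + 1) ks = a \<longleftrightarrow> set (take (N + 1 - a) ks) \<subseteq> {0}"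
    "exit_row (s_interval a N) (N + 1) ks = a \<Longrightarrow> occ_after (s_interval a N) (N + 1) ks = ks"
    by simp_all
qed

text \<open>A particle in a row \<open>x\<close> of the block passes freely until the letter \<open>x\<close>, where it raises the
  occupation number, and then falls through the remaining empty sites.\<close>

lemma block_low_row:
  assumes "1 \<le> a" "a \<le> N + 1" "x \<le> N"
  shows "exit_row (s_interval a N) x (replicate (N + 1 - a) 0 @ t) = (if x < a then x else a)"
    and "occ_after (s_interval a N) x (replicate (N + 1 - a) 0 @ t) =
      (if x < a then replicate (N + 1 - a) 0 @ t
       else replicate (N - x) 0 @ 1 # replicate (x - a) 0 @ t)"
proof -
  have "exit_row (s_interval a N) x (replicate (N + 1 - a) 0 @ t) = (if x < a then x else a) \<and>
    occ_after (s_interval a N) x (replicate (N + 1 - a) 0 @ t) =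
      (if x < a then replicate (N + 1 - a) 0 @ t
       else replicate (N - x) 0 @ 1 # replicate (x - a) 0 @ t)"
    using assms
  proof (induction N)
    case 0
    then show ?case by (simp add: s_interval_empty)
  next
    case (Suc N)
    show ?case
    proof (cases "a = Suc N + 1")
      case True
      then show ?thesis using Suc.prems by (simp add: s_interval_empty)
    next
      case False
      with Suc.prems have a: "a \<le> Suc N" by simp
      show ?thesis
      proof (cases "x = Suc N")
        case True
        have "exit_row (s_interval a N) (N + 1) (replicate (Suc N - a) 0 @ t) = a"
          by (subst block_top_row(2)) (use a Suc.prems in auto)
        moreover from this
        have "occ_after (s_interval a N) (N + 1) (replicate (Suc N - a) 0 @ t) =
            replicate (Suc N - a) 0 @ t"
          by (rule block_top_row(3)[rotated -1]) (use a Suc.prems in auto)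
        ultimately show ?thesis
          using a True by (simp add: s_interval_Suc Suc_diff_le next_row_def next_occ_def)
      next
        case False
        then show ?thesis
          using a Suc.prems Suc.IH
          by (auto simp add: s_interval_Suc Suc_diff_le next_row_def next_occ_def)
      qed
    qed
  qed
  then show "exit_row (s_interval a N) x (replicate (N + 1 - a) 0 @ t) = (if x < a then x else a)"
    "occ_after (s_interval a N) x (replicate (N + 1 - a) 0 @ t) =
      (if x < a then replicate (N + 1 - a) 0 @ t
       else replicate (N - x) 0 @ 1 # replicate (x - a) 0 @ t)"
    by blast+
qed

text \<open>The counterpart of \<open>block_low_row\<close>: starting from the top row, the particle removes the excitation
  at the letter \<open>x\<close>, and the row in which it leaves records \<open>x\<close>.\<close>

lemma block_top_row_unit:
  assumes "1 \<le> a" "a \<le> x" "x \<le> N"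
  shows "exit_row (s_interval a N) (N + 1) (replicate (N - x) 0 @ 1 # replicate (x - a) 0 @ t) = x + 1"
    and "occ_after (s_interval a N) (N + 1) (replicate (N - x) 0 @ 1 # replicate (x - a) 0 @ t) =
      replicate (N + 1 - a) 0 @ t"
proof -
  have "exit_row (s_interval a N) (N + 1) (replicate (N - x) 0 @ 1 # replicate (x - a) 0 @ t) = x + 1 \<and>
    occ_after (s_interval a N) (N + 1) (replicate (N - x) 0 @ 1 # replicate (x - a) 0 @ t) =
      replicate (N + 1 - a) 0 @ t"
    using assms
  proof (induction N)
    case (Suc N)
    then have a: "a \<le> Suc N" by simp
    show ?case
    proof (cases "x = Suc N")
      case True
      have ab: "\<forall>r\<in>set (s_interval a N). r + 1 < Suc (Suc N)" by (auto simp: set_s_interval)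
      show ?thesis
        using a True exit_row_above[OF ab, of "replicate (x - a) 0 @ t"] occ_after_above[OF ab, of "replicate (x - a) 0 @ t"]
        by (simp add: s_interval_Suc Suc_diff_le next_row_def next_occ_def length_s_interval)
    next
      case False
      then show ?thesis
        using a Suc.prems Suc.IH
        by (simp add: s_interval_Suc Suc_diff_le next_row_def next_occ_def)
    qed
  qed simp
  then show "exit_row (s_interval a N) (N + 1) (replicate (N - x) 0 @ 1 # replicate (x - a) 0 @ t) = x + 1"
    "occ_after (s_interval a N) (N + 1) (replicate (N - x) 0 @ 1 # replicate (x - a) 0 @ t) =
      replicate (N + 1 - a) 0 @ t" by blast+
qed

context
  fixes V :: "nat list" and a N m :: nat
  assumes V: "\<forall>r\<in>set V. r < N"
    and a: "1 \<le> a" "a \<le> N + 1"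
    and m: "length V + (N + 1 - a) \<le> m"
begin

lemma top_row_op:
  shows "j < a \<Longrightarrow> row_op m (V @ s_interval a N) (N + 1) j f = (\<lambda>ks. 0)"
    and "row_op m (V @ s_interval a N) (N + 1) a = vac_proj m (length V)"
proof -
  let ?v = "s_interval a N"
  have *: "row_op m (V @ ?v) (N + 1) j f ks =
      (if length ks = m \<and> set (drop (length V + (N + 1 - a)) ks) \<subseteq> {0} \<and>
          exit_row ?v (N + 1) (drop (length V) ks) = j
       then f (take (length V) ks @ occ_after ?v (N + 1) (drop (length V) ks)) else 0)" for j f ks
  proof (cases "length ks = m")
    case True
    have V': "\<forall>r\<in>set V. r + 1 < N + 1" using V by simp
    show ?thesis
      using exit_row_append[of "take (length V) ks" V ?v "N + 1" "drop (length V) ks"]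
        occ_after_append[of "take (length V) ks" V ?v "N + 1" "drop (length V) ks"] m True
        exit_row_above[OF V', of "take (length V) ks"] occ_after_above[OF V', of "take (length V) ks"]
      by (simp add: row_op_def length_s_interval)
  qed (simp add: row_op_def)
  show "row_op m (V @ ?v) (N + 1) j f = (\<lambda>ks. 0)" if "j < a"
  proof
    fix ks :: "nat list"
    show "row_op m (V @ ?v) (N + 1) j f ks = 0"
      unfolding * using block_top_row(1)[OF a, of "drop (length V) ks"] that m
      by (cases "length ks = m") (auto simp: le_diff_conv2)
  qed
  show "row_op m (V @ ?v) (N + 1) a = vac_proj m (length V)"
  proof (intro ext)
    fix f :: "nat list \<Rightarrow> complex" and ks :: "nat list"
    have "set (drop (length V) ks) = set (take (N + 1 - a) (drop (length V) ks)) \<union>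
        set (drop (N + 1 - a) (drop (length V) ks))"
      by (metis append_take_drop_id set_append)
    then show "row_op m (V @ ?v) (N + 1) a f ks = vac_proj m (length V) f ks"
    proof (cases "length ks = m")
      case True
      then have le: "N + 1 - a \<le> length (drop (length V) ks)" using m by simp
      show ?thesis
        unfolding * vac_proj_def using \<open>set (drop (length V) ks) = _\<close> block_top_row(2,3)[OF a le]
        by (auto simp: add.commute)
    qed (simp add: row_op_def vac_proj_def)
  qed
qed

lemma vacuum_tail:
  assumes "length ks = m" "set (drop (length V) ks) \<subseteq> {0}"
  shows "ks = take (length V) ks @ replicate (N + 1 - a) 0 @ replicate (m - length V - (N + 1 - a)) 0"
proof -
  have "drop (length V) ks = replicate (m - length V) 0"
    using assms by (auto intro: replicate_eqI)
  also have "m - length V = (N + 1 - a) + (m - length V - (N + 1 - a))"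
    using m by simp
  finally show ?thesis
    by (metis append_take_drop_id replicate_add)
qed

text \<open>After the word \<open>V\<close> the particle of row \<open>i\<close> is in some row \<open>x\<close>, and it then meets the vacuum.  If \<open>x < a\<close>,
  it leaves unchanged in row \<open>x\<close>; otherwise it leaves in row \<open>a\<close> and the information about \<open>x\<close> is
  stored as an excitation at the letter \<open>x\<close>.  In the second case a particle in the top row reads
  this information off and restores the vacuum.\<close>

lemma row_op_compress:
  assumes i: "i \<le> N"
  shows "j < a \<Longrightarrow>
      vac_proj m (length V) (row_op m (V @ s_interval a N) i j (vac_proj m (length V) f)) =
      row_op m V i j f"
    and "a \<le> j \<Longrightarrow>
      vac_proj m (length V) (row_op m (V @ s_interval a N) i a
        (row_op m (V @ s_interval a N) (N + 1) (j + 1) (vac_proj m (length V) f))) =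
      row_op m V i j f"
proof -
  let ?v = "s_interval a N"
  let ?P = "\<lambda>ks. length ks = m \<and> set (drop (length V) ks) \<subseteq> {0}"
  have off: "row_op m V i j f ks = 0" "vac_proj m (length V) g ks = 0" if "\<not> ?P ks" for j f g ks
    using that by (auto simp: row_op_def vac_proj_def)
  have V': "\<forall>r\<in>set V. r + 1 < N + 1" using V by simp
  { fix ks :: "nat list" assume P: "?P ks"
    \<comment> \<open>\<open>z\<close> is the vacuum of the block and \<open>t\<close> that of the sites behind it; \<open>u\<close> is what the block and
      the sites behind it look like once a particle has come in from row \<open>x \<ge> a\<close>.\<close>
    define ks1 where "ks1 = take (length V) ks"
    define z where "z = replicate (N + 1 - a) (0::nat)"
    define t where "t = replicate (m - length V - (N + 1 - a)) (0::nat)"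
    define x where "x = exit_row V i ks1"
    define ls where "ls = occ_after V i ks1"
    define u where "u = replicate (N - x) 0 @ 1 # replicate (x - a) 0 @ t"
    have ks: "ks = ks1 @ z @ t"
      using vacuum_tail P unfolding ks1_def z_def t_def by blast
    have l1: "length ks1 = length V" using P m by (simp add: ks1_def)
    have lz: "length z = N + 1 - a" "length t = m - length V - (N + 1 - a)"
      by (simp_all add: z_def t_def)
    have ll: "length ls = length V" by (simp add: ls_def length_occ_after l1)
    have x: "x \<le> N" using exit_row_le[of V i ks1] i by (simp add: x_def)
    have t0: "set t \<subseteq> {0}" "set z \<subseteq> {0}" by (auto simp: t_def z_def)
    have V1: "exit_row V i ks = x" "occ_after V i ks = ls @ z @ t"
      using exit_row_append[OF l1, of "[]"] occ_after_append[OF l1, of "[]"]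
      by (simp_all add: ks x_def ls_def)
    have Vv: "exit_row (V @ ?v) i ks = (if x < a then x else a)"
      "occ_after (V @ ?v) i ks = ls @ (if x < a then z @ t else u)"
      unfolding ks exit_row_append[OF l1] occ_after_append[OF l1] x_def[symmetric] ls_def[symmetric]
        z_def u_def by (simp_all only: block_low_row[OF a x])
    have top: "exit_row (V @ ?v) (N + 1) (ls @ u) = x + 1"
      "occ_after (V @ ?v) (N + 1) (ls @ u) = ls @ z @ t" if "a \<le> x"
      unfolding exit_row_append[OF ll] occ_after_append[OF ll] exit_row_above[OF V']
        occ_after_above[OF V' eq_refl[OF ll[symmetric]]]
      using block_top_row_unit[OF a(1) that x] by (simp_all add: u_def z_def)
    have lu: "length u = N + 1 - a + length t" if "a \<le> x"
      using that x by (simp add: u_def)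
    have du: "drop (N + 1 - a) u = t" if "a \<le> x"
      using that x by (simp add: u_def Suc_diff_le)
    have V0: "row_op m V i j f ks = (if x = j then f (ls @ z @ t) else 0)" for j
      using P by (simp add: row_op_def V1)
    have v0: "vac_proj m (length V) g ks = g ks" for g
      using P by (simp add: vac_proj_def)
    have v1: "vac_proj m (length V) g (ls @ z @ t) = g (ls @ z @ t)" for g
      using t0 lz ll m by (simp add: vac_proj_def)
    have R: "row_op m (V @ ?v) i j g ks =
        (if (if x < a then x else a) = j then g (ls @ (if x < a then z @ t else u)) else 0)" for j g
    proof -
      have "drop (length (V @ ?v)) ks = t"
        by (simp add: ks l1 lz length_s_interval)
      then show ?thesis using P t0 by (simp add: row_op_def Vv)
    qed
    have T: "row_op m (V @ ?v) (N + 1) (j + 1) g (ls @ u) = (if x = j then g (ls @ z @ t) else 0)"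
      if "a \<le> x" for j g
      using t0 ll m lu[OF that] du[OF that] lz
      by (simp add: row_op_def top[OF that, simplified] length_s_interval)
    have "vac_proj m (length V) (row_op m (V @ ?v) i j (vac_proj m (length V) f)) ks =
        row_op m V i j f ks" if "j < a"
      using that by (simp add: v0 R V0 v1)
    moreover have "vac_proj m (length V) (row_op m (V @ ?v) i a
        (row_op m (V @ ?v) (N + 1) (j + 1) (vac_proj m (length V) f))) ks = row_op m V i j f ks"
      if "a \<le> j"
      unfolding v0 R V0 using T[of j] that by (auto simp: v1)
    note calculation this
  } note * = this
  show "vac_proj m (length V) (row_op m (V @ ?v) i j (vac_proj m (length V) f)) = row_op m V i j f"
    if "j < a"
  proof
    fix ks :: "nat list" show "vac_proj m (length V) (row_op m (V @ ?v) i j (vac_proj m (length V) f)) ks =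
        row_op m V i j f ks"
      using *(1)[of ks, OF _ that] off[of ks] by (cases "?P ks") auto
  qed
  show "vac_proj m (length V) (row_op m (V @ ?v) i a
      (row_op m (V @ ?v) (N + 1) (j + 1) (vac_proj m (length V) f))) = row_op m V i j f"
    if "a \<le> j"
  proof
    fix ks :: "nat list" show "vac_proj m (length V) (row_op m (V @ ?v) i a
      (row_op m (V @ ?v) (N + 1) (j + 1) (vac_proj m (length V) f))) ks = row_op m V i j f ks"
      using *(2)[of ks, OF _ that] off[of ks] by (cases "?P ks") auto
  qed
qed

end


section \<open>Words as products of blocks\<close>

definition block_word :: "(nat \<Rightarrow> nat) \<Rightarrow> nat \<Rightarrow> nat list" where
  "block_word \<alpha> N = concat (map (\<lambda>r. s_interval (\<alpha> r) r) [1..<N + 1])"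

lemma block_word_0: "block_word \<alpha> 0 = []"
  by (simp add: block_word_def)

lemma block_word_Suc:
  "block_word \<alpha> (Suc N) = block_word \<alpha> N @ s_interval (\<alpha> (Suc N)) (Suc N)"
  by (simp add: block_word_def)

lemma set_block_word: "set (block_word \<alpha> N) \<subseteq> {..N}"
  by (auto simp: block_word_def set_s_interval)

lemma block_word_cong:
  "(\<And>r. r \<in> {1..N} \<Longrightarrow> \<alpha> r = \<beta> r) \<Longrightarrow> block_word \<alpha> N = block_word \<beta> N"
  unfolding block_word_def by (intro arg_cong[where f = concat] map_cong) auto

text \<open>A missing upper end \<open>r\<close> is filled in by \<open>\<alpha> r = r + 1\<close>, which gives the empty block.\<close>

lemma interval_word_eq_block_word:
  assumes ab: "\<forall>i\<in>{1..k}. 1 \<le> a i \<and> a i \<le> b i \<and> b i \<le> n"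
    and b: "\<forall>i\<in>{1..k}. \<forall>j\<in>{1..k}. i < j \<longrightarrow> b j < b i"
  obtains \<alpha> where "\<And>r. r \<in> {1..n} \<Longrightarrow> \<alpha> r \<in> {1..r + 1}"
    and "interval_word k a b = block_word \<alpha> n"
proof
  define B where "B = b ` {1..k}"
  define \<alpha> where "\<alpha> r = (if r \<in> B then a (the_inv_into {1..k} b r) else r + 1)" for r
  have inj: "inj_on b {1..k}"
    using b by (intro inj_onI) (metis less_irrefl linorder_neqE_nat)
  have \<alpha>b: "\<alpha> (b i) = a i" if "i \<in> {1..k}" for i
    unfolding \<alpha>_def B_def using the_inv_into_f_f[OF inj that] that by simp
  show "\<alpha> r \<in> {1..r + 1}" if "r \<in> {1..n}" for r
  proof (cases "r \<in> B")
    case True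
    then obtain i where "i \<in> {1..k}" "r = b i" by (auto simp: B_def)
    then show ?thesis using ab \<alpha>b by force
  qed (simp add: \<alpha>_def)
  have Bn: "B \<subseteq> {1..n}"
    using ab by (force simp: B_def)
  \<comment> \<open>Both sides list the elements of \<open>B\<close> in increasing order, since \<open>b\<close> is decreasing.\<close>
  have sorted: "filter (\<lambda>r. r \<in> B) [1..<n + 1] = map b (rev [1..<k + 1])"
  proof (rule sorted_distinct_set_unique)
    show "sorted (map b (rev [1..<k + 1]))"
      unfolding rev_map[symmetric] sorted_rev_iff_nth_mono
    proof (intro allI impI)
      fix i j assume "i \<le> j" "j < length (map b [1..<k + 1])"
      then show "map b [1..<k + 1] ! j \<le> map b [1..<k + 1] ! i"
        using b[rule_format, of "i + 1" "j + 1"] by (cases "i = j") (auto simp del: upt_Suc)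
    qed
    show "distinct (map b (rev [1..<k + 1]))"
      using inj by (auto simp: distinct_map atLeastLessThanSuc_atLeastAtMost simp del: upt_Suc)
    show "set (filter (\<lambda>r. r \<in> B) [1..<n + 1]) = set (map b (rev [1..<k + 1]))"
      using Bn by (auto simp: B_def atLeastLessThanSuc_atLeastAtMost simp del: upt_Suc)
  qed (simp_all del: upt_Suc add: sorted_wrt_filter)
  have drop_empty: "concat (map (\<lambda>r. s_interval (\<alpha> r) r) xs) =
      concat (map (\<lambda>r. s_interval (\<alpha> r) r) (filter (\<lambda>r. r \<in> B) xs))" for xs
    by (induction xs) (auto simp: \<alpha>_def s_interval_empty)
  have "block_word \<alpha> n = concat (map (\<lambda>i. s_interval (\<alpha> (b i)) (b i)) (rev [1..<k + 1]))"
    unfolding block_word_def by (subst drop_empty) (simp only: sorted map_map o_def)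
  also have "map (\<lambda>i. s_interval (\<alpha> (b i)) (b i)) (rev [1..<k + 1]) =
      map (\<lambda>i. s_interval (a i) (b i)) (rev [1..<k + 1])"
    by (rule map_cong) (auto simp: \<alpha>b)
  finally show "interval_word k a b = block_word \<alpha> n"
    by (simp add: interval_word_def)
qed


section \<open>Recovering the word from an intertwining map\<close>

lemma row_op_Nil: "row_op m [] i i = vac_proj m 0"
  by (intro ext) (auto simp: row_op_def vac_proj_def)

text \<open>The factor \<open>d\<close> takes account of the fact that the scalars of the two representations may differ
  a priori.\<close>

definition intertwines ::
    "nat \<Rightarrow> ((nat list \<Rightarrow> complex) \<Rightarrow> nat list \<Rightarrow> complex) \<Rightarrow> complex \<Rightarrow>
     ((nat list \<Rightarrow> complex) \<Rightarrow> nat list \<Rightarrow> complex) \<Rightarrow>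
     ((nat list \<Rightarrow> complex) \<Rightarrow> nat list \<Rightarrow> complex) \<Rightarrow> bool" where
  "intertwines m U d T T' \<longleftrightarrow>
     (\<forall>f\<in>l2 (tensor_index m). T f \<in> l2 (tensor_index m) \<and> U (T f) = (\<lambda>ks. d * T' (U f) ks))"

lemma intertwines_comp:
  assumes "intertwines m U d T T'" "intertwines m U e R R'"
    and "\<And>c g. T' (\<lambda>ks. c * g ks) = (\<lambda>ks. c * T' g ks)"
  shows "intertwines m U (d * e) (\<lambda>f. T (R f)) (\<lambda>f. T' (R' f))"
  using assms by (simp add: intertwines_def mult.assoc)

lemma vac_proj_scale: "vac_proj m l (\<lambda>ks. c * f ks) = (\<lambda>ks. c * vac_proj m l f ks)"
  by (auto simp: vac_proj_def)

lemma row_op_scale: "row_op m w i j (\<lambda>ks. c * f ks) = (\<lambda>ks. c * row_op m w i j f ks)"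
  by (auto simp: row_op_def)

lemma vac_proj_idem: "vac_proj m l (vac_proj m l f) = vac_proj m l f"
  by (auto simp: vac_proj_def)

definition vacuum :: "nat \<Rightarrow> nat list \<Rightarrow> complex" where
  "vacuum m = (\<lambda>ks. if ks = replicate m 0 then 1 else 0)"

lemma vacuum_l2: "vacuum m \<in> l2 (tensor_index m)"
  unfolding vacuum_def by (rule l2_delta) simp

lemma vac_proj_vacuum: "vac_proj m l (vacuum m) = vacuum m"
  by (auto simp: vac_proj_def vacuum_def fun_eq_iff dest: in_set_dropD)

lemma vacuum_nonzero: "vacuum m \<noteq> (\<lambda>ks. 0)"
  by (auto simp: vacuum_def fun_eq_iff)

context
  fixes m m' :: nat and U :: "(nat list \<Rightarrow> complex) \<Rightarrow> nat list \<Rightarrow> complex"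
  assumes hom: "\<And>c f. f \<in> l2 (tensor_index m) \<Longrightarrow> U (\<lambda>ks. c * f ks) = (\<lambda>ks. c * U f ks)"
    and bij: "bij_betw U (l2 (tensor_index m)) (l2 (tensor_index m'))"
begin

lemma U_zero: "U (\<lambda>ks. 0) = (\<lambda>ks. 0)"
  using hom[OF vacuum_l2, of 0] by simp

lemma U_vacuum: "U (vacuum m) \<noteq> (\<lambda>ks. 0)"
proof
  assume *: "U (vacuum m) = (\<lambda>ks. 0)"
  have "(\<lambda>ks. 0) \<in> l2 (tensor_index m)" by (simp add: l2_def)
  moreover have "U (vacuum m) = U (\<lambda>ks. 0)"
    by (simp only: * U_zero)
  ultimately have "vacuum m = (\<lambda>ks. 0)"
    using inj_onD[OF bij_betw_imp_inj_on[OF bij]] vacuum_l2 by blast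
  with vacuum_nonzero show False by blast
qed

text \<open>Comparing \<open>d\<close> and \<open>d\<^sup>2\<close> by means of idempotency; the vacuum vector shows that the projections do not
  vanish.\<close>

lemma intertwined_projections:
  assumes "intertwines m U d (vac_proj m l) (vac_proj m' l')"
  shows "d = 1"
proof -
  have *: "U (vac_proj m l f) = (\<lambda>ks. d * vac_proj m' l' (U f) ks)"
    if "f \<in> l2 (tensor_index m)" for f
    using assms that by (simp add: intertwines_def)
  let ?g = "vac_proj m' l' (U (vacuum m))"
  have g: "U (vacuum m) = (\<lambda>ks. d * ?g ks)"
    using *[OF vacuum_l2] by (simp add: vac_proj_vacuum)
  then have "?g = vac_proj m' l' (\<lambda>ks. d * ?g ks)"
    by (rule arg_cong)
  then have "?g = (\<lambda>ks. d * ?g ks)"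
    by (simp only: vac_proj_scale vac_proj_idem)
  moreover obtain ks where "U (vacuum m) ks \<noteq> 0"
    using U_vacuum by auto
  then have "?g ks \<noteq> 0"
    using fun_cong[OF g, of ks] by auto
  ultimately show "d = 1"
    by (metis mult_cancel_right1)
qed

text \<open>This detects the first nonzero operator in a row.  The first case rests on injectivity of \<open>U\<close>,
  the second one on surjectivity.\<close>

lemma no_intertwining_with_zero:
  assumes "intertwines m U d T T'" "d \<noteq> 0"
  shows "(\<And>f. T f = vac_proj m l f) \<Longrightarrow> (\<And>f. T' f = (\<lambda>ks. 0)) \<Longrightarrow> False"
    and "(\<And>f. T f = (\<lambda>ks. 0)) \<Longrightarrow> (\<And>f. T' f = vac_proj m' l f) \<Longrightarrow> False"
proof -
  show False if T: "\<And>f. T f = vac_proj m l f" and T': "\<And>f. T' f = (\<lambda>ks. 0)"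
  proof -
    have "U (T (vacuum m)) = (\<lambda>ks. d * T' (U (vacuum m)) ks)"
      using assms vacuum_l2 by (simp add: intertwines_def)
    then show False using U_vacuum by (simp add: T T' vac_proj_vacuum)
  qed
  show False if T: "\<And>f. T f = (\<lambda>ks. 0)" and T': "\<And>f. T' f = vac_proj m' l f"
  proof -
    have "vacuum m' \<in> U ` l2 (tensor_index m)"
      using bij vacuum_l2[of m'] by (simp add: bij_betw_def)
    then obtain f where f: "f \<in> l2 (tensor_index m)" "U f = vacuum m'"
      by auto
    have "U (T f) = (\<lambda>ks. d * T' (U f) ks)"
      using assms f by (simp add: intertwines_def)
    then have "(\<lambda>ks. d * vacuum m' ks) = (\<lambda>ks. 0)"
      by (simp add: T T' f U_zero vac_proj_vacuum)
    then show False
      using assms(2) vacuum_nonzero[of m'] by (auto simp: fun_eq_iff)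
  qed
qed

text \<open>The induction removes the last block.  The top row yields its lower end and its scalar; with
  this scalar known, the compressions are intertwined with the same factors \<open>d i\<close> as before.\<close>

lemma intertwined_rows_determine_word:
  assumes "\<And>r. r \<in> {1..N} \<Longrightarrow> \<alpha> r \<in> {1..r + 1}" "\<And>r. r \<in> {1..N} \<Longrightarrow> \<beta> r \<in> {1..r + 1}"
    and "length (block_word \<alpha> N) \<le> m" "length (block_word \<beta> N) \<le> m'"
    and "\<And>i. i \<in> {1..N + 1} \<Longrightarrow> d i \<noteq> 0"
    and "\<And>i j. i \<in> {1..N + 1} \<Longrightarrow> j \<in> {1..i} \<Longrightarrow>
      intertwines m U (d i) (row_op m (block_word \<alpha> N) i j) (row_op m' (block_word \<beta> N) i j)"
  shows "(\<forall>r\<in>{1..N}. \<alpha> r = \<beta> r) \<and> (\<forall>i\<in>{1..N + 1}. d i = 1)"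
  using assms
proof (induction N)
  case 0
  have "intertwines m U (d 1) (vac_proj m 0) (vac_proj m' 0)"
    using 0(6)[of 1 1] by (simp add: block_word_0 row_op_Nil)
  then have "d 1 = 1" by (rule intertwined_projections)
  then show ?case by auto
next
  case (Suc N)
  let ?V = "block_word \<alpha> N" and ?V' = "block_word \<beta> N"
  let ?a = "\<alpha> (Suc N)" and ?b = "\<beta> (Suc N)"
  have V: "\<forall>r\<in>set ?V. r < Suc N" "\<forall>r\<in>set ?V'. r < Suc N"
    using set_block_word by (fastforce simp: less_Suc_eq_le)+
  have a: "1 \<le> ?a" "?a \<le> Suc N + 1" and b: "1 \<le> ?b" "?b \<le> Suc N + 1"
    using Suc.prems(1,2)[of "Suc N"] by auto
  have m: "length ?V + (Suc N + 1 - ?a) \<le> m" "length ?V' + (Suc N + 1 - ?b) \<le> m'"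
    using Suc.prems(3,4) by (simp_all add: block_word_Suc length_s_interval)
  note top = top_row_op[OF V(1) a m(1)] and top' = top_row_op[OF V(2) b m(2)]
  note comp = row_op_compress[OF V(1) a m(1)] and comp' = row_op_compress[OF V(2) b m(2)]
  let ?T = "row_op m (?V @ s_interval ?a (Suc N))" and ?T' = "row_op m' (?V' @ s_interval ?b (Suc N))"
  let ?Q = "vac_proj m (length ?V)" and ?Q' = "vac_proj m' (length ?V')"
  have tw: "intertwines m U (d i) (?T i j) (?T' i j)" if "i \<in> {1..Suc N + 1}" "j \<in> {1..i}" for i j
    using Suc.prems(6)[OF that] by (simp add: block_word_Suc)
  have d: "d (Suc N + 1) \<noteq> 0" using Suc.prems(5) by simp
  have ab: "?a = ?b"
  proof (rule ccontr)
    assume "?a \<noteq> ?b"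
    then consider "?a < ?b" | "?b < ?a" by linarith
    then show False
    proof cases
      case 1
      have "intertwines m U (d (Suc N + 1)) (?T (Suc N + 1) ?a) (?T' (Suc N + 1) ?a)"
        by (rule tw) (use a in auto)
      from no_intertwining_with_zero(1)[OF this d fun_cong[OF top(2)] top'(1)[OF 1]]
      show False .
    next
      case 2
      have "intertwines m U (d (Suc N + 1)) (?T (Suc N + 1) ?b) (?T' (Suc N + 1) ?b)"
        by (rule tw) (use b in auto)
      from no_intertwining_with_zero(2)[OF this d top(1)[OF 2] fun_cong[OF top'(2)]]
      show False .
    qed
  qed
  have "intertwines m U (d (Suc N + 1)) ?Q ?Q'"
    using tw[of "Suc N + 1" ?a] a unfolding top(2) top'(2)[folded ab] ab[symmetric]
    by simp
  moreover from this have d1: "d (Suc N + 1) = 1" by (rule intertwined_projections)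
  ultimately have Q: "intertwines m U 1 ?Q ?Q'" by simp
  have below: "intertwines m U (d i) (row_op m ?V i j) (row_op m' ?V' i j)"
    if i: "i \<in> {1..N + 1}" and j: "j \<in> {1..i}" for i j
  proof (cases "j < ?a")
    case True
    have "intertwines m U (1 * (d i * 1)) (\<lambda>f. ?Q (?T i j (?Q f))) (\<lambda>f. ?Q' (?T' i j (?Q' f)))"
      by (intro intertwines_comp[OF Q] intertwines_comp[OF tw Q] vac_proj_scale row_op_scale)
        (use i j in auto)
    moreover have "?Q (?T i j (?Q f)) = row_op m ?V i j f"
      "?Q' (?T' i j (?Q' f)) = row_op m' ?V' i j f" for f
      using comp(1)[of i j] comp'(1)[of i j] True i by (auto simp: ab)
    ultimately show ?thesis by simp
  next
    case False
    have "intertwines m U (1 * (d i * (d (Suc N + 1) * 1)))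
        (\<lambda>f. ?Q (?T i ?a (?T (Suc N + 1) (j + 1) (?Q f))))
        (\<lambda>f. ?Q' (?T' i ?a (?T' (Suc N + 1) (j + 1) (?Q' f))))"
      by (intro intertwines_comp[OF Q] intertwines_comp[OF tw intertwines_comp[OF tw Q]]
          vac_proj_scale row_op_scale)
        (use i j a False in auto)
    moreover have "?Q (?T i ?a (?T (Suc N + 1) (j + 1) (?Q f))) = row_op m ?V i j f"
      "?Q' (?T' i ?a (?T' (Suc N + 1) (j + 1) (?Q' f))) = row_op m' ?V' i j f" for f
      using comp(2)[of i j] comp'(2)[of i j] False i by (auto simp: ab)
    ultimately show ?thesis by (simp add: d1[simplified])
  qed
  have "(\<forall>r\<in>{1..N}. \<alpha> r = \<beta> r) \<and> (\<forall>i\<in>{1..N + 1}. d i = 1)"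
  proof (rule Suc.IH)
    show "length ?V \<le> m" "length ?V' \<le> m'" using m by linarith+
  qed (use Suc.prems(1,2,5) below in auto)
  then show ?case using ab d1 by (auto simp: le_Suc_eq)
qed

end


section \<open>Inequivalence\<close>

lemma representation_generator:
  assumes psi: "is_psi n A z lam w \<psi>" and w: "set w \<subseteq> {1..n}"
    and ij: "i \<in> {1..n + 1}" "j \<in> {1..i}"
    and f: "f \<in> l2 (tensor_index (length w))"
  shows "\<psi> (z i j) f =
    (\<lambda>ks. cnj (ext_lam n lam (i - 1)) * ext_lam n lam i * row_op (length w) w i j f ks)"
    (is "_ = (\<lambda>ks. ?c * _ ks)")
proof
  fix ks
  let ?I = "tensor_index (length w)"
  have j: "j \<in> {1..n + 1}" using ij by auto
  let ?X = "\<lambda>q::real. scale (l2_ops ?I) (of_real ((- q) powi min (int i - int j) 0))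
      (psi_q n q lam w i j)"
  have lim: "cstar_tendsto (l2_ops ?I) ?X (\<psi> (z i j)) (at_right 0)"
    using psi ij(1) j by (simp add: is_psi_def)
  show "\<psi> (z i j) f ks = ?c * row_op (length w) w i j f ks"
  proof (cases "length ks = length w")
    case True
    let ?S = "\<lambda>q. ?c * (\<Sum>p\<in>paths n (length w) i j. tensor_op
        (map (\<lambda>t. psi_letter q (w ! t) (p ! t) (p ! (t + 1))) [0..<length w]) f ks)"
    have "min (int i - int j) 0 = 0" using ij(2) by simp
    then have X: "?X q f ks = ?S q" for q
      using f by (simp add: l2_ops_def psi_q_def paths_def)
    have "((\<lambda>q. ?X q f ks) \<longlongrightarrow> \<psi> (z i j) f ks) (at_right 0)"
      by (rule cstar_tendsto_pointwise[OF lim f])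
    moreover have "(?S \<longlongrightarrow> ?S 0) (at_right 0)"
      by (intro tendsto_mult tendsto_const tendsto_sum tensor_op_tendsto_0[where g = "\<lambda>q. f"])
    ultimately have "\<psi> (z i j) f ks = ?S 0"
      unfolding X by (intro tendsto_unique) auto
    also have "\<dots> = ?c * row_op (length w) w i j f ks"
      using path_sum_at_0[OF w ij(1) True] True by (simp add: row_op_def)
    finally show ?thesis .
  next
    case False
    have "\<psi> (z i j) \<in> bounded_ops ?I"
      using lim by (simp add: cstar_tendsto_def l2_ops_def)
    then have "\<psi> (z i j) f \<in> l2 ?I"
      using f by (auto simp: bounded_ops_def)
    then show ?thesis
      using False by (auto simp: l2_def row_op_def)
  qed
qed

lemma ext_lam_unimodular:
  "lam \<in> {1..n} \<rightarrow>\<^sub>E sphere 0 1 \<Longrightarrow> cmod (ext_lam n lam i) = 1"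
  by (auto simp: ext_lam_def PiE_def Pi_def)

text \<open>The scalars are the successive quotients of the numbers \<open>ext_lam n lam i\<close>, which start with \<open>1\<close>.\<close>

lemma ext_lam_determined:
  assumes lam: "lam \<in> {1..n} \<rightarrow>\<^sub>E sphere 0 1" "lam' \<in> {1..n} \<rightarrow>\<^sub>E sphere 0 1"
    and eq: "\<And>i. i \<in> {1..n + 1} \<Longrightarrow> cnj (ext_lam n lam (i - 1)) * ext_lam n lam i =
      cnj (ext_lam n lam' (i - 1)) * ext_lam n lam' i"
  shows "lam = lam'"
proof -
  have "ext_lam n lam i = ext_lam n lam' i" if "i \<le> n" for i
    using that
  proof (induction i)
    case 0
    show ?case by (simp add: ext_lam_def)
  next
    case (Suc i)
    have "cnj (ext_lam n lam i) \<noteq> 0"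
      using ext_lam_unimodular[OF lam(1), of i] by auto
    then show ?case
      using eq[of "Suc i"] Suc by simp
  qed
  then have "lam i = lam' i" if "i \<in> {1..n}" for i
    using that by (force simp: ext_lam_def)
  then show ?thesis by (rule PiE_ext[OF lam])
qed

theorem theorem3p9:
  fixes n k k' :: nat
    and A :: "'a cstar" and z :: "nat \<Rightarrow> nat \<Rightarrow> 'a"
    and lam lam' :: "nat \<Rightarrow> complex"
    and a b a' b' :: "nat \<Rightarrow> nat"
    and w w' :: "nat list"
    and \<psi> \<psi>' :: "'a \<Rightarrow> (nat list \<Rightarrow> complex) \<Rightarrow> (nat list \<Rightarrow> complex)"
  assumes "n \<ge> 2"
    and "is_C_SU0 n A z"
    and "lam \<in> {1..n} \<rightarrow>\<^sub>E sphere 0 1"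
    and "lam' \<in> {1..n} \<rightarrow>\<^sub>E sphere 0 1"
    and "1 \<le> k" "k \<le> n"
    and "\<forall>i\<in>{1..k}. 1 \<le> a i \<and> a i \<le> b i \<and> b i \<le> n"
    and "\<forall>i\<in>{1..k}. \<forall>j\<in>{1..k}. i < j \<longrightarrow> b j < b i"
    and "w = interval_word k a b" and "reduced_word n w"
    and "1 \<le> k'" "k' \<le> n"
    and "\<forall>i\<in>{1..k'}. 1 \<le> a' i \<and> a' i \<le> b' i \<and> b' i \<le> n"
    and "\<forall>i\<in>{1..k'}. \<forall>j\<in>{1..k'}. i < j \<longrightarrow> b' j < b' i"
    and "w' = interval_word k' a' b'" and "reduced_word n w'"
    and "is_psi n A z lam w \<psi>"
    and "is_psi n A z lam' w' \<psi>'"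
    and "(lam, w) \<noteq> (lam', w')"
  shows "\<not> unitarily_equivalent A (tensor_index (length w)) \<psi> (tensor_index (length w')) \<psi>'"
proof
  assume "unitarily_equivalent A (tensor_index (length w)) \<psi> (tensor_index (length w')) \<psi>'"
  then obtain U where U: "l2_unitary (tensor_index (length w)) (tensor_index (length w')) U"
    and UA: "\<And>x f. x \<in> carrier A \<Longrightarrow> f \<in> l2 (tensor_index (length w)) \<Longrightarrow> U (\<psi> x f) = \<psi>' x (U f)"
    unfolding unitarily_equivalent_def by blast
  let ?I = "tensor_index (length w)"
  have hom: "\<And>c f. f \<in> l2 ?I \<Longrightarrow> U (\<lambda>ks. c * f ks) = (\<lambda>ks. c * U f ks)"
    and bij: "bij_betw U (l2 ?I) (l2 (tensor_index (length w')))"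
    using U by (auto simp: l2_unitary_def linear_on_l2_def)
  obtain \<alpha> where \<alpha>: "\<And>r. r \<in> {1..n} \<Longrightarrow> \<alpha> r \<in> {1..r + 1}" "w = block_word \<alpha> n"
    using interval_word_eq_block_word[OF assms(7,8)] assms(9) by metis
  obtain \<beta> where \<beta>: "\<And>r. r \<in> {1..n} \<Longrightarrow> \<beta> r \<in> {1..r + 1}" "w' = block_word \<beta> n"
    using interval_word_eq_block_word[OF assms(13,14)] assms(15) by metis
  define c where "c i = cnj (ext_lam n lam (i - 1)) * ext_lam n lam i" for i
  define c' where "c' i = cnj (ext_lam n lam' (i - 1)) * ext_lam n lam' i" for i
  have c0: "c i \<noteq> 0" "c' i \<noteq> 0" for i
    using ext_lam_unimodular[OF assms(3)] ext_lam_unimodular[OF assms(4)]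
    unfolding c_def c'_def by (metis complex_cnj_zero_iff mult_eq_0_iff norm_zero zero_neq_one)+
  have tw: "intertwines (length w) U (c' i / c i)
      (row_op (length w) w i j) (row_op (length w') w' i j)"
    if ij: "i \<in> {1..n + 1}" "j \<in> {1..i}" for i j
    unfolding intertwines_def
  proof
    fix f assume f: "f \<in> l2 ?I"
    have Uf: "U f \<in> l2 (tensor_index (length w'))"
      using bij f by (auto simp: bij_betw_def)
    have w: "set w \<subseteq> {1..n}" "set w' \<subseteq> {1..n}"
      using assms(10,16) by (auto simp: reduced_word_def)
    note gen = representation_generator[OF assms(17) w(1) ij f, folded c_def]
    note gen' = representation_generator[OF assms(18) w(2) ij Uf, folded c'_def]
    have z: "z i j \<in> carrier A"
      using assms(2) ij by (auto simp: is_C_SU0_def SU0_relations_def)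
    have "\<psi> (z i j) \<in> bounded_ops ?I"
      using assms(17) z by (auto simp: is_psi_def unital_star_hom_def ring_hom_def l2_ops_def)
    then have "\<psi> (z i j) f \<in> l2 ?I"
      using f by (auto simp: bounded_ops_def)
    then have R: "row_op (length w) w i j f \<in> l2 ?I"
      using l2_scale[of "\<psi> (z i j) f" ?I "1 / c i"] c0(1)[of i] by (simp add: gen)
    have "(\<lambda>ks. c i * U (row_op (length w) w i j f) ks) = (\<lambda>ks. c' i * row_op (length w') w' i j (U f) ks)"
      using UA[OF z f] unfolding gen gen' hom[OF R] .
    then have "U (row_op (length w) w i j f) = (\<lambda>ks. c' i / c i * row_op (length w') w' i j (U f) ks)"
      using c0(1)[of i] by (auto simp: fun_eq_iff field_simps)
    with R show "row_op (length w) w i j f \<in> l2 ?I \<and>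
        U (row_op (length w) w i j f) = (\<lambda>ks. c' i / c i * row_op (length w') w' i j (U f) ks)" ..
  qed
  have det: "(\<forall>r\<in>{1..n}. \<alpha> r = \<beta> r) \<and> (\<forall>i\<in>{1..n + 1}. c' i / c i = 1)"
  proof (intro intertwined_rows_determine_word[OF hom bij])
    show "c' i / c i \<noteq> 0" for i using c0 by simp
    show "length (block_word \<alpha> n) \<le> length w" "length (block_word \<beta> n) \<le> length w'"
      by (simp_all only: \<alpha>(2) \<beta>(2))
    show "intertwines (length w) U (c' i / c i) (row_op (length w) (block_word \<alpha> n) i j)
        (row_op (length w') (block_word \<beta> n) i j)"
      if "i \<in> {1..n + 1}" "j \<in> {1..i}" for i j
      using tw[OF that] by (simp only: \<alpha>(2)[symmetric] \<beta>(2)[symmetric])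
  qed (rule \<alpha>(1) \<beta>(1) | assumption)+
  then have w: "w = w'"
    unfolding \<alpha>(2) \<beta>(2) by (intro block_word_cong) simp
  have c: "c i = c' i" if "i \<in> {1..n + 1}" for i
    using det c0 that by auto
  have "lam = lam'"
    by (rule ext_lam_determined[OF assms(3,4) c[unfolded c_def c'_def]])
  with w show False using assms(19) by simp
qed

end
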